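(* (1) There exists a map $\psi:\mathbb C^n\to\mathfrak g^*$ such that $W_0(d\pi(X))(z)=i\langle\psi(z),X\rangle$ for each $X\in\mathfrak g$ and each $z\in\mathbb C^n$. Then we have $\psi(g\cdot z)=\mathrm{Ad}^*(g)\,\psi(z)$ for each $g\in G$ and each $z\in\mathbb C^n$. (2) For each $z\in\mathbb C^n$, $$\psi(z)=\left(-i\,d\chi+\tfrac12\sum_{k=1}^n(1-\lambda|z_k|^2)\alpha_k,\ -\lambda z,\ \lambda\right).$$ (3) Moreover, $\psi$ is a bijection from $\mathbb C^n$ onto the orbit $\mathcal O(\xi_0)$, for the coadjoint action of $G$, of the element $$\xi_0:=\left(-i\,d\chi+\tfrac12\sum_{k=1}^n\alpha_k,\ 0,\ \lambda\right)\in\mathfrak g^*.$$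
   Context: Fix integers $n,m\ge 1$ and $\lambda>0$. For $z,w\in\mathbb C^n$ put $zw:=\sum_k z_kw_k$ (bilinear), $|z|^2=z\bar z$, and $\omega((z,w),(z',w')):=\tfrac i2(zw'-z'w)$. Let $\alpha_1,\dots,\alpha_n$ be linear forms on $\mathbb R^m$; for $t\in\mathbb R^m$, $t\cdot z=(e^{i\alpha_1(t)}z_1,\dots,e^{i\alpha_n(t)}z_n)$, $\alpha(t)z=(\alpha_1(t)z_1,\dots,\alpha_n(t)z_n)$, and $t^{-1}$ means $-t$. The generalized diamond group $G$ is $\mathbb R^m\times\mathbb C^n\times\mathbb R$ with $(t,z,c)\cdot(t',z',c')=(t+t',\,z+t\cdot z',\,c+c'+\tfrac12\omega((z,\bar z),(t\cdot z',\overline{t\cdot z'})))$. It acts on $\mathbb C^n$ by $(t,z_0,c_0)\cdot z=t\cdot z+z_0$. Its Lie algebra $\mathfrak g$ consists of $(t,u,c)\in\mathbb R^m\times\mathbb C^n\times\mathbb R$ (tangent space at the identity), with bracket $[(t,u,c),(t',u',c')]=(0,i(\alpha(t)u'-\alpha(t')u),\omega((u,\bar u),(u',\bar u')))$. For $s\in(\mathbb R^m)^*$, $v\in\mathbb C^n$, $d\in\mathbb R$, $\xi=(s,v,d)$ denotes the element of $\mathfrak g^*$ with $\langle\xi,(t,u,c)\rangle=\langle s,t\rangle+\omega((v,\bar v),(u,\bar u))+cd$. The coadjoint action is $\langle\mathrm{Ad}^*(g)\xi,X\rangle=\langle\xi,\mathrm{Ad}(g)^{-1}X\rangle$. $\mathcal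 F_\lambda$ is the Hilbert space of holomorphic $f$ on $\mathbb C^n$ with $\int_{\mathbb C^n}|f(z)|^2e^{-\lambda|z|^2/2}d\mu_\lambda(z)<\infty$, $d\mu_\lambda=(2\pi)^{-n}\lambda^n\,dx\,dy$, $z=x+iy$. Fix a unitary character $\chi$ of $\mathbb R^m$ with differential $d\chi$ at $0$ (so $\chi(t)=e^{d\chi(t)}$). The unitary representation $\pi$ of $G$ on $\mathcal F_\lambda$ is $(\pi(t,z_0,c_0)f)(z)=\chi(t)\exp(i\lambda c_0+\tfrac\lambda2\bar z_0z-\tfrac\lambda4|z_0|^2)f(t^{-1}\cdot(z-z_0))$, and $d\pi(X)f=\frac{d}{ds}\pi(\exp(sX))f\big|_{s=0}$ (defined in particular on coherent states $e_z(w)=\exp(\lambda\bar zw/2)$). For an operator $A$ defined on coherent states, $k_A(z,w)=\langle Ae_w,e_z\rangle$ and the complex Weyl symbol is, whenever the integral converges, $$W_0(A)(z)=2^n\int_{\mathbb C^n}k_A(z+w,z-w)\exp\left(\tfrac\lambda2(-z\bar z-w\bar w+z\bar w-\bar zw)\right)d\mu_\lambda(w).$$ *)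

theory Defs
  imports "HOL-Analysis.Analysis" "HOL-Algebra.Group_Action"
begin

section \<open>The generalized diamond group\<close>

text \<open>
  The character usually called chi is written \<open>ch\<close> below, because the Greek letter is
  the vector binder of HOL-Analysis.  Lambda is written \<open>lam\<close>.
\<close>

text \<open>
  The triple \<open>(t, z, c)\<close>.  The group is an open subset (all) of this vector space, so the
  same type is its tangent space at the identity, i.e. its Lie algebra.
\<close>
type_synonym ('m, 'n) diamond = "(real ^ 'm) \<times> (complex ^ 'n) \<times> real"

definition bil :: "complex ^ 'n::finite \<Rightarrow> complex ^ 'n \<Rightarrow> complex" where
  "bil z w = (\<Sum>k\<in>UNIV. z $ k * w $ k)"

definition cnjv :: "complex ^ 'n::finite \<Rightarrow> complex ^ 'n" where
  "cnjv z = (\<chi> k. cnj (z $ k))"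

fun omega :: "(complex ^ 'n::finite) \<times> (complex ^ 'n) \<Rightarrow> (complex ^ 'n) \<times> (complex ^ 'n) \<Rightarrow> complex"
  where "omega (z, w) (z', w') = (\<i> / 2) * (bil z w' - bil z' w)"

text \<open>
  On pairs \<open>(z, cnjv z)\<close> the form \<open>omega\<close> is real-valued (next lemma); \<open>symp\<close> is
  that value as a real number.
\<close>
definition symp :: "complex ^ 'n::finite \<Rightarrow> complex ^ 'n \<Rightarrow> real" where
  "symp z w = Re (omega (z, cnjv z) (w, cnjv w))"

lemma omega_cnjv_real: "omega (z, cnjv z) (w, cnjv w) = complex_of_real (symp z w)"
proof -
  have "cnj (bil z (cnjv w)) = bil w (cnjv z)"
    by (simp add: bil_def cnjv_def mult.commute)
  then have "bil z (cnjv w) - bil w (cnjv z) = complex_of_real (2 * Im (bil z (cnjv w))) * \<i>"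
    by (metis complex_diff_cnj)
  then show ?thesis
    by (simp add: symp_def complex_eq_iff)
qed

definition torus_act :: "('n::finite \<Rightarrow> real ^ 'm::finite \<Rightarrow> real) \<Rightarrow> real ^ 'm \<Rightarrow> complex ^ 'n \<Rightarrow> complex ^ 'n"
  where "torus_act \<alpha> t z = (\<chi> k. exp (\<i> * complex_of_real (\<alpha> k t)) * z $ k)"

fun diamond_mult :: "('n::finite \<Rightarrow> real ^ 'm::finite \<Rightarrow> real) \<Rightarrow>
    ('m, 'n) diamond \<Rightarrow> ('m, 'n) diamond \<Rightarrow> ('m, 'n) diamond"
  where "diamond_mult \<alpha> (t, z, c) (t', z', c') =
    (t + t', z + torus_act \<alpha> t z', c + c' + symp z (torus_act \<alpha> t z') / 2)"

definition diamond_group :: "('n::finite \<Rightarrow> real ^ 'm::finite \<Rightarrow> real) \<Rightarrow> ('m, 'n) diamond monoid"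
  where "diamond_group \<alpha> = \<lparr>carrier = UNIV, mult = diamond_mult \<alpha>, one = (0, 0, 0)\<rparr>"

lemma bil_torus_act:
  "bil (torus_act \<alpha> t z) (cnjv (torus_act \<alpha> t w)) = bil z (cnjv w)"
proof -
  have "exp (\<i> * complex_of_real x) * cnj (exp (\<i> * complex_of_real x)) = 1" for x
    by (simp flip: complex_norm_square)
  then show ?thesis
    by (auto simp: bil_def cnjv_def torus_act_def mult.assoc mult.left_commute
        intro!: sum.cong)
qed

lemma symp_torus_act: "symp (torus_act \<alpha> t z) (torus_act \<alpha> t w) = symp z w"
  by (simp add: symp_def bil_torus_act)

lemma group_diamond_group:
  assumes "\<And>k. linear (\<alpha> k)"
  shows "group (diamond_group \<alpha>)"
proof (rule groupI)
  have add: "\<alpha> k (s + t) = \<alpha> k s + \<alpha> k t" and zero: "\<alpha> k 0 = 0" for k s t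
    using assms by (auto simp: linear_add linear_0)
  have ta: "torus_act \<alpha> (s + t) z = torus_act \<alpha> s (torus_act \<alpha> t z)" for s t z
    by (simp add: torus_act_def add distrib_left exp_add mult.assoc)
  have t0: "torus_act \<alpha> 0 z = z" for z
    by (simp add: torus_act_def zero vec_eq_iff)
  have tadd: "torus_act \<alpha> t (z + w) = torus_act \<alpha> t z + torus_act \<alpha> t w" for t z w
    by (simp add: torus_act_def vec_eq_iff distrib_left)
  have sl: "symp (z + w) u = symp z u + symp w u"
    and sr: "symp u (z + w) = symp u z + symp u w" for z w u
    by (simp_all add: symp_def bil_def cnjv_def algebra_simps sum.distrib)
  have s0: "symp 0 z = 0" "symp z 0 = 0" for z
    by (simp_all add: symp_def bil_def cnjv_def)
  have sn: "symp (- z) z = 0" for z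
    by (simp add: symp_def bil_def cnjv_def sum_negf mult.commute)
  fix x y z
  show "\<one>\<^bsub>diamond_group \<alpha>\<^esub> \<in> carrier (diamond_group \<alpha>)"
    "x \<otimes>\<^bsub>diamond_group \<alpha>\<^esub> y \<in> carrier (diamond_group \<alpha>)"
    by (simp_all add: diamond_group_def)
  show "x \<otimes>\<^bsub>diamond_group \<alpha>\<^esub> y \<otimes>\<^bsub>diamond_group \<alpha>\<^esub> z =
    x \<otimes>\<^bsub>diamond_group \<alpha>\<^esub> (y \<otimes>\<^bsub>diamond_group \<alpha>\<^esub> z)"
    by (cases x; cases y; cases z)
      (simp add: diamond_group_def ta tadd sl sr symp_torus_act add.assoc add_divide_distrib)
  show "\<one>\<^bsub>diamond_group \<alpha>\<^esub> \<otimes>\<^bsub>diamond_group \<alpha>\<^esub> x = x"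
    by (cases x) (simp add: diamond_group_def t0 s0)
  obtain t u c where x: "x = (t, u, c)" by (cases x)
  have "diamond_mult \<alpha> (- t, - torus_act \<alpha> (- t) u, - c) x = (0, 0, 0)"
    by (simp add: x sn)
  then show "\<exists>y\<in>carrier (diamond_group \<alpha>). y \<otimes>\<^bsub>diamond_group \<alpha>\<^esub> x = \<one>\<^bsub>diamond_group \<alpha>\<^esub>"
    by (auto simp: diamond_group_def)
qed

fun diamond_act :: "('n::finite \<Rightarrow> real ^ 'm::finite \<Rightarrow> real) \<Rightarrow>
    ('m, 'n) diamond \<Rightarrow> complex ^ 'n \<Rightarrow> complex ^ 'n"
  where "diamond_act \<alpha> (t, z0, c0) z = torus_act \<alpha> t z + z0"

text \<open>The exponential map: time one of the one-parameter subgroup with initial velocity \<open>X\<close>.\<close>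
definition diamond_exp :: "('n::finite \<Rightarrow> real ^ 'm::finite \<Rightarrow> real) \<Rightarrow>
    ('m, 'n) diamond \<Rightarrow> ('m, 'n) diamond"
  where "diamond_exp \<alpha> X = (THE g. \<exists>\<gamma>.
    (\<forall>s s'. \<gamma> (s + s') = \<gamma> s \<otimes>\<^bsub>diamond_group \<alpha>\<^esub> \<gamma> s') \<and>
    (\<gamma> has_vector_derivative X) (at 0) \<and> g = \<gamma> (1::real))"

text \<open>The differential at the identity of conjugation by \<open>g\<close>.\<close>
definition Ad :: "('n::finite \<Rightarrow> real ^ 'm::finite \<Rightarrow> real) \<Rightarrow>
    ('m, 'n) diamond \<Rightarrow> ('m, 'n) diamond \<Rightarrow> ('m, 'n) diamond"
  where "Ad \<alpha> g = frechet_derivative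
    (\<lambda>h. g \<otimes>\<^bsub>diamond_group \<alpha>\<^esub> h \<otimes>\<^bsub>diamond_group \<alpha>\<^esub> m_inv (diamond_group \<alpha>) g)
    (at \<one>\<^bsub>diamond_group \<alpha>\<^esub>)"

text \<open>
  The dual of the Lie algebra is the set of linear functionals on \<open>('m, 'n) diamond\<close>, as
  functions into the reals.
\<close>
definition dual_elem :: "(real ^ 'm::finite \<Rightarrow> real) \<Rightarrow> complex ^ 'n::finite \<Rightarrow> real \<Rightarrow>
    ('m, 'n) diamond \<Rightarrow> real"
  where "dual_elem s v d = (\<lambda>(t, u, c). s t + symp v u + c * d)"

definition Ad_star :: "('n::finite \<Rightarrow> real ^ 'm::finite \<Rightarrow> real) \<Rightarrow>
    ('m, 'n) diamond \<Rightarrow> (('m, 'n) diamond \<Rightarrow> real) \<Rightarrow> ('m, 'n) diamond \<Rightarrow> real"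
  where "Ad_star \<alpha> g \<xi> = (\<lambda>X. \<xi> (inv_into UNIV (Ad \<alpha> g) X))"


section \<open>Fock space and the representation\<close>

definition mu :: "real \<Rightarrow> (complex ^ 'n::finite) measure" where
  "mu lam = density lborel (\<lambda>_. ennreal ((lam / (2 * pi)) ^ CARD('n)))"

definition holomorphic_vec :: "(complex ^ 'n::finite \<Rightarrow> complex) \<Rightarrow> bool" where
  "holomorphic_vec f \<longleftrightarrow>
    (\<forall>z. \<exists>D. (f has_derivative D) (at z) \<and> (\<forall>a v. D (a *s v) = a * D v))"

definition fock_space :: "real \<Rightarrow> (complex ^ 'n::finite \<Rightarrow> complex) set" where
  "fock_space lam = {f. holomorphic_vec f \<and>
    integrable (mu lam) (\<lambda>z. (cmod (f z))\<^sup>2 * exp (- lam * (norm z)\<^sup>2 / 2))}"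

definition fock_inner :: "real \<Rightarrow> (complex ^ 'n::finite \<Rightarrow> complex) \<Rightarrow>
    (complex ^ 'n \<Rightarrow> complex) \<Rightarrow> complex"
  where "fock_inner lam f g =
    (LINT z|mu lam. f z * cnj (g z) * complex_of_real (exp (- lam * (norm z)\<^sup>2 / 2)))"

definition fock_norm :: "real \<Rightarrow> (complex ^ 'n::finite \<Rightarrow> complex) \<Rightarrow> real" where
  "fock_norm lam f = sqrt (LINT z|mu lam. (cmod (f z))\<^sup>2 * exp (- lam * (norm z)\<^sup>2 / 2))"

definition coherent :: "real \<Rightarrow> complex ^ 'n::finite \<Rightarrow> complex ^ 'n \<Rightarrow> complex" where
  "coherent lam z = (\<lambda>w. exp (complex_of_real lam * bil (cnjv z) w / 2))"

definition unitary_character :: "(real ^ 'm::finite \<Rightarrow> complex) \<Rightarrow> bool" where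
  "unitary_character ch \<longleftrightarrow> continuous_on UNIV ch \<and>
    (\<forall>s t. ch (s + t) = ch s * ch t) \<and> (\<forall>t. cmod (ch t) = 1)"

fun diamond_rep :: "('n::finite \<Rightarrow> real ^ 'm::finite \<Rightarrow> real) \<Rightarrow> real \<Rightarrow> (real ^ 'm \<Rightarrow> complex) \<Rightarrow>
    ('m, 'n) diamond \<Rightarrow> (complex ^ 'n \<Rightarrow> complex) \<Rightarrow> complex ^ 'n \<Rightarrow> complex"
  where "diamond_rep \<alpha> lam ch (t, z0, c0) f = (\<lambda>z.
    ch t * exp (\<i> * complex_of_real (lam * c0) + complex_of_real (lam / 2) * bil (cnjv z0) z
                - complex_of_real (lam / 4 * (norm z0)\<^sup>2))
    * f (torus_act \<alpha> (- t) (z - z0)))"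

text \<open>
  \<open>h\<close> is the derivative of \<open>s \<mapsto> \<pi>(exp(sX)) f\<close> at \<open>s = 0\<close> with respect to the norm of the
  Fock space; at most one such \<open>h\<close> exists.
\<close>
definition has_drep :: "('n::finite \<Rightarrow> real ^ 'm::finite \<Rightarrow> real) \<Rightarrow> real \<Rightarrow> (real ^ 'm \<Rightarrow> complex) \<Rightarrow>
    ('m, 'n) diamond \<Rightarrow> (complex ^ 'n \<Rightarrow> complex) \<Rightarrow> (complex ^ 'n \<Rightarrow> complex) \<Rightarrow> bool"
  where "has_drep \<alpha> lam ch X f h \<longleftrightarrow> f \<in> fock_space lam \<and> h \<in> fock_space lam \<and>
    ((\<lambda>s::real. fock_norm lam (\<lambda>z.
        (diamond_rep \<alpha> lam ch (diamond_exp \<alpha> (s *\<^sub>R X)) f z - f z) / complex_of_real s - h z))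
      \<longlongrightarrow> 0) (at 0)"

definition drep :: "('n::finite \<Rightarrow> real ^ 'm::finite \<Rightarrow> real) \<Rightarrow> real \<Rightarrow> (real ^ 'm \<Rightarrow> complex) \<Rightarrow>
    ('m, 'n) diamond \<Rightarrow> (complex ^ 'n \<Rightarrow> complex) \<Rightarrow> complex ^ 'n \<Rightarrow> complex"
  where "drep \<alpha> lam ch X f = (THE h. has_drep \<alpha> lam ch X f h)"


section \<open>The complex Weyl symbol\<close>

definition berezin_kernel :: "real \<Rightarrow> ((complex ^ 'n::finite \<Rightarrow> complex) \<Rightarrow> complex ^ 'n \<Rightarrow> complex) \<Rightarrow>
    complex ^ 'n \<Rightarrow> complex ^ 'n \<Rightarrow> complex"
  where "berezin_kernel lam A z w = fock_inner lam (A (coherent lam w)) (coherent lam z)"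

definition weyl_integrand :: "real \<Rightarrow> ((complex ^ 'n::finite \<Rightarrow> complex) \<Rightarrow> complex ^ 'n \<Rightarrow> complex) \<Rightarrow>
    complex ^ 'n \<Rightarrow> complex ^ 'n \<Rightarrow> complex"
  where "weyl_integrand lam A z w = berezin_kernel lam A (z + w) (z - w) *
    exp (complex_of_real (lam / 2) *
      (- bil z (cnjv z) - bil w (cnjv w) + bil z (cnjv w) - bil (cnjv z) w))"

text \<open>Only meaningful where the integral converges, i.e. where the integrand is integrable.\<close>
definition weyl_symbol :: "real \<Rightarrow> ((complex ^ 'n::finite \<Rightarrow> complex) \<Rightarrow> complex ^ 'n \<Rightarrow> complex) \<Rightarrow>
    complex ^ 'n \<Rightarrow> complex"
  where "weyl_symbol lam A z = 2 ^ CARD('n) * (LINT w|mu lam. weyl_integrand lam A z w)"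

end

(*
  On a coherent state e_w the operator d pi (T, u, c) is multiplication by a function affine in
  the variable v,
    d chi(T) + i lam c - lam/2 bar(w) u + lam/2 (bar(u) - i alpha(T) bar(w)) v.
  The derivative is taken in the Fock norm: pi(exp(sX)) e_w has the form a(s) exp(b(s) v), its
  difference quotients are dominated by C exp(D |v|), and dominated convergence against the
  Gaussian weight applies.  By the reproducing property of coherent states the kernel is this
  function times the reproducing kernel, so the Weyl integrand is a polynomial of degree two in
  w, bar(w) times exp(-lam |w|^2).  The terms linear in w integrate to 0, and the second moments
  of |w_k|^2 produce the summand 1/2 alpha_k of psi.  Equivariance is a computation with the
  closed form of Ad, and bijectivity follows since the translations act transitively and -lam z
  determines z.
*)
theory Submission
  imports Defs "HOL-Probability.Characteristic_Functions" "HOL-Real_Asymp.Real_Asymp"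
begin

section \<open>Gaussian integrals\<close>

text \<open>\<open>diamond_exp\<close>, \<open>Ad\<close> and \<open>drep\<close> are given by
  characterisation, through \<open>THE\<close> or a Frechet derivative, so each has to be evaluated
  before any computation can start. For the exponential this takes an explicit one-parameter
  subgroup together with a uniqueness theorem, although only its first-order behaviour at
  \<open>s = 0\<close> reaches the symbol. For \<open>drep\<close>, uniqueness rests on Fock
  elements being continuous functions rather than classes modulo null sets. All Gaussian integrals
  come from one formula with independent complex coefficients for \<open>v\<close> and its
  conjugate. At decay rate lam/2 it is the reproducing property; at rate lam, centred, it evaluates
  the Weyl integral. The doubled rate is what the factor 2^n in the symbol compensates. The summand
  1/2 alpha_k is the second moment 1/lam times the coefficient lam/2 alpha_k of |w_k|^2. The
  functional -i d chi is written with \<open>Re\<close> to be real-valued; since a unitary character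
  has imaginary differential, this changes nothing.\<close>

lemma has_bochner_integral_lborel_prod:
  fixes f :: "'a::euclidean_space \<Rightarrow> real \<Rightarrow> 'b::{real_normed_field,banach,second_countable_topology}"
  assumes "\<And>b. b \<in> Basis \<Longrightarrow> has_bochner_integral lborel (f b) (I b)"
  shows "has_bochner_integral lborel (\<lambda>x::'a. \<Prod>b\<in>Basis. f b (x \<bullet> b)) (\<Prod>b\<in>Basis. I b)"
proof -
  interpret product_sigma_finite "\<lambda>_::'a. lborel :: real measure" ..
  have [measurable]: "f b \<in> borel_measurable borel" if "b \<in> Basis" for b
    using borel_measurable_has_bochner_integral[OF assms[OF that]] by simp
  have "has_bochner_integral (\<Pi>\<^sub>M b\<in>Basis. lborel) (\<lambda>x. \<Prod>b\<in>Basis. f b (x b)) (\<Prod>b\<in>Basis. I b)"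
    using assms
    by (auto simp: has_bochner_integral_iff product_integral_prod intro!: product_integrable_prod)
  \<comment> \<open>\<open>lborel_eq\<close> presents Lebesgue measure as the image of the product
    measure under the coordinate parametrisation, whose inner product with \<open>b\<close> is the
    \<open>b\<close>-th coordinate.\<close>
  then show ?thesis
    by (subst lborel_eq, subst has_bochner_integral_distr)
      (auto simp: inner_sum_left inner_Basis if_distrib cong: if_cong prod.cong)
qed

text \<open>
  The imaginary part of \<open>p\<close> is covered by the characteristic function of the normal
  distribution, the real part by completing the square.
\<close>
lemma gaussian_1d:
  fixes p :: complex
  assumes k: "k > 0"
  shows "has_bochner_integral lborel (\<lambda>x::real. exp (p * x - k * x\<^sup>2)) (sqrt (pi / k) * exp (p\<^sup>2 / (4 * k)))"
proof -
  define a b where "a = Re p" and "b = Im p"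
  have p: "p = a + \<i> * b" by (simp add: a_def b_def complex_eq)
  \<comment> \<open>Substituting y = - a/c + c x, the choice c^2 = 2k gives y^2/2 = k x^2 - a x +
    a^2/(4k), and t = b/c is the frequency in the variable y. The two constants left over, from the
    square and from the phase, are the prefactor introduced below.\<close>
  define c where "c = sqrt (2 * k)"
  have c: "c > 0" "c\<^sup>2 = 2 * k" using k by (auto simp: c_def)
  define t where "t = b / c"
  have "(CLINT x|lborel. std_normal_density x *\<^sub>R iexp (t * x)) = exp (- (t\<^sup>2) / 2)"
    using fun_cong[OF char_std_normal_distribution, of t]
    by (simp add: char_def integral_density)
  moreover have "integrable lborel (\<lambda>x. std_normal_density x *\<^sub>R iexp (t * x))"
    by (rule Bochner_Integration.integrable_bound[of _ "\<lambda>x. std_normal_density x"]) auto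
  ultimately have "has_bochner_integral lborel (\<lambda>x. std_normal_density x *\<^sub>R iexp (t * x))
      (complex_of_real (exp (- (t\<^sup>2) / 2)))"
    by (simp add: has_bochner_integral_iff)
  then have "has_bochner_integral lborel
      (\<lambda>x. std_normal_density (- a / c + c * x) *\<^sub>R iexp (t * (- a / c + c * x)))
      (complex_of_real (exp (- (t\<^sup>2) / 2)) /\<^sub>R c)"
    using c by (subst (asm) lborel_has_bochner_integral_real_affine_iff[of c _ _ "- a / c"]) simp_all
  then have "has_bochner_integral lborel
      (\<lambda>x. complex_of_real (sqrt (2 * pi)) * exp (a\<^sup>2 / (4*k) + \<i> * (a * b / (2*k))) *
         (std_normal_density (- a / c + c * x) *\<^sub>R iexp (t * (- a / c + c * x))))
      (complex_of_real (sqrt (2 * pi)) * exp (a\<^sup>2 / (4*k) + \<i> * (a * b / (2*k))) *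
         (complex_of_real (exp (- (t\<^sup>2) / 2)) /\<^sub>R c))"
    by (intro has_bochner_integral_mult_right) auto
  also have "(\<lambda>x. complex_of_real (sqrt (2 * pi)) * exp (a\<^sup>2 / (4*k) + \<i> * (a * b / (2*k))) *
         (std_normal_density (- a / c + c * x) *\<^sub>R iexp (t * (- a / c + c * x)))) =
      (\<lambda>x. exp (p * x - k * x\<^sup>2))"
  proof
    fix x :: real
    have 1: "t * (- a / c + c * x) = b * x - a * b / (2 * k)"
      using c k by (simp add: t_def field_simps power2_eq_square)
    have 2: "(- a / c + c * x)\<^sup>2 / 2 = k * x\<^sup>2 - a * x + a\<^sup>2 / (4 * k)"
    proof -
      have "(- a / c + c * x)\<^sup>2 = a\<^sup>2 / c\<^sup>2 - 2 * a * x + c\<^sup>2 * x\<^sup>2"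
        using c(1) by (simp add: power2_eq_square field_simps)
      then show ?thesis using k by (simp add: c(2) field_simps)
    qed
    have "complex_of_real (sqrt (2 * pi)) * exp (a\<^sup>2 / (4*k) + \<i> * (a * b / (2*k))) *
         (std_normal_density (- a / c + c * x) *\<^sub>R iexp (t * (- a / c + c * x))) =
       exp (a\<^sup>2 / (4*k) + \<i> * (a * b / (2*k))) * exp (complex_of_real (- ((- a / c + c * x)\<^sup>2 / 2))) *
         iexp (t * (- a / c + c * x))"
      by (simp add: std_normal_density_def scaleR_conv_of_real exp_of_real[symmetric])
    also have "\<dots> = exp (p * x - k * x\<^sup>2)"
      unfolding 1 2 p by (simp add: exp_add[symmetric] algebra_simps)
    finally show "complex_of_real (sqrt (2 * pi)) * exp (a\<^sup>2 / (4*k) + \<i> * (a * b / (2*k))) *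
         (std_normal_density (- a / c + c * x) *\<^sub>R iexp (t * (- a / c + c * x))) = exp (p * x - k * x\<^sup>2)" .
  qed
  also have "complex_of_real (sqrt (2 * pi)) * exp (a\<^sup>2 / (4*k) + \<i> * (a * b / (2*k))) *
         (complex_of_real (exp (- (t\<^sup>2) / 2)) /\<^sub>R c) = sqrt (pi / k) * exp (p\<^sup>2 / (4 * k))"
  proof -
    have 1: "t\<^sup>2 = b\<^sup>2 / (2 * k)" by (simp add: t_def power_divide c)
    have 2: "sqrt (pi / k) = sqrt (2 * pi) / c"
      using k by (simp add: c_def real_sqrt_divide real_sqrt_mult)
    have 3: "p\<^sup>2 / (4 * k) = a\<^sup>2 / (4*k) + \<i> * (a * b / (2*k)) + complex_of_real (- (t\<^sup>2) / 2)"
      using k unfolding 1 p by (simp add: power2_eq_square field_simps)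
    show ?thesis
      unfolding 2 3 exp_add by (simp add: exp_of_real[symmetric] scaleR_conv_of_real field_simps)
  qed
  finally show ?thesis by simp
qed

lemma gaussian_1d_real:
  assumes k: "k > 0"
  shows "has_bochner_integral lborel (\<lambda>x::real. exp (- k * x\<^sup>2)) (sqrt (pi / k))"
proof -
  have eq: "exp (0 * complex_of_real x - complex_of_real (k * x\<^sup>2)) = complex_of_real (exp (- k * x\<^sup>2))" for x :: real
    unfolding exp_of_real[symmetric] by simp
  have "has_bochner_integral lborel (\<lambda>x::real. complex_of_real (exp (- k * x\<^sup>2))) (complex_of_real (sqrt (pi / k)))"
    using gaussian_1d[OF k, of 0] unfolding eq by simp
  then show ?thesis
    by (simp add: has_bochner_integral_iff complex_of_real_integrable_eq)
qed

lemma integrable_gaussian: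
  assumes k: "k > 0"
  shows "integrable lborel (\<lambda>x::'a::euclidean_space. exp (- k * (norm x)\<^sup>2))"
proof -
  have "integrable lborel (\<lambda>x::real. exp (- k * x\<^sup>2))"
    using gaussian_1d_real[OF k] by (simp add: has_bochner_integral_iff)
  then have "has_bochner_integral lborel (\<lambda>x::'a. \<Prod>b\<in>Basis. exp (- k * (x \<bullet> b)\<^sup>2))
      (\<Prod>b\<in>(Basis :: 'a set). LBINT x. exp (- k * x\<^sup>2))"
    by (intro has_bochner_integral_lborel_prod) (auto simp: has_bochner_integral_iff)
  moreover have "(\<Prod>b\<in>Basis. exp (- k * (x \<bullet> b)\<^sup>2)) = exp (- k * (norm x)\<^sup>2)" for x :: 'a
    unfolding power2_norm_eq_inner
    by (simp add: exp_sum[symmetric] euclidean_inner[of x x] sum_distrib_left power2_eq_square sum_negf)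
  ultimately show ?thesis
    by (simp add: has_bochner_integral_iff)
qed

text \<open>Half of the Gaussian decay absorbs the growth: D r - (k/2) r^2 is at most D^2/(2k) by
  completing the square, and the other half stays as an integrable majorant.\<close>

lemma integrable_gaussian_exp_growth:
  fixes f :: "'a::euclidean_space \<Rightarrow> 'b::{banach,second_countable_topology,real_normed_vector}"
  assumes k: "k > 0" and [measurable]: "f \<in> borel_measurable borel"
    and le: "\<And>x. norm (f x) \<le> C * exp (D * norm x)"
  shows "integrable lborel (\<lambda>x. exp (- k * (norm x)\<^sup>2) *\<^sub>R f x)"
proof (rule Bochner_Integration.integrable_bound)
  show "integrable lborel (\<lambda>x::'a. C * exp (D\<^sup>2 / (2 * k)) * exp (- (k/2) * (norm x)\<^sup>2))"
    using integrable_gaussian[of "k/2", where 'a = 'a] k by (intro integrable_mult_right) auto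
  have C: "C \<ge> 0" using le[of 0] order_trans[OF norm_ge_zero] by auto
  have "norm (exp (- k * (norm x)\<^sup>2) *\<^sub>R f x) \<le> norm (C * exp (D\<^sup>2 / (2 * k)) * exp (- (k/2) * (norm x)\<^sup>2))" for x
  proof -
    have "norm (exp (- k * (norm x)\<^sup>2) *\<^sub>R f x) \<le> exp (- k * (norm x)\<^sup>2) * (C * exp (D * norm x))"
      using le[of x] by simp
    also have "\<dots> = C * exp (D * norm x - k * (norm x)\<^sup>2)"
      by (simp add: exp_diff exp_minus field_simps)
    also have "\<dots> \<le> C * exp (D\<^sup>2 / (2*k) - (k/2) * (norm x)\<^sup>2)"
    proof -
      have "D * norm x - k * (norm x)\<^sup>2 \<le> D\<^sup>2 / (2*k) - (k/2) * (norm x)\<^sup>2"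
      proof -
        have "0 \<le> (D - k * norm x)\<^sup>2 / (2 * k)" using k by simp
        also have "\<dots> = D\<^sup>2 / (2*k) - D * norm x + (k/2) * (norm x)\<^sup>2"
          using k by (simp add: power2_eq_square field_simps)
        finally show ?thesis by simp
      qed
      then show ?thesis using C by (simp add: mult_left_mono)
    qed
    also have "\<dots> = C * exp (D\<^sup>2 / (2 * k)) * exp (- (k/2) * (norm x)\<^sup>2)"
      by (simp add: exp_add[symmetric] algebra_simps)
    finally show ?thesis by (rule order_trans) simp
  qed
  then show "AE x in lborel. norm (exp (- k * (norm x)\<^sup>2) *\<^sub>R f x)
      \<le> norm (C * exp (D\<^sup>2 / (2 * k)) * exp (- (k/2) * (norm x)\<^sup>2))" by simp
qed simp

lemma integral_derivative_eq_0:
  fixes F f :: "real \<Rightarrow> 'a::euclidean_space"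
  assumes "\<And>x. (F has_vector_derivative f x) (at x)" "\<And>x. isCont f x" "integrable lborel f"
    and "(F \<longlongrightarrow> 0) at_top" "(F \<longlongrightarrow> 0) at_bot"
  shows "has_bochner_integral lborel f 0"
proof -
  have "(LBINT x=-\<infinity>..\<infinity>. f x) = 0 - 0"
    using assms
    by (intro interval_integral_FTC_integrable[where F = F])
       (auto simp: ereal_tendsto_simps set_integrable_def einterval_def)
  then show ?thesis
    using assms by (simp add: has_bochner_integral_iff interval_lebesgue_integral_def set_lebesgue_integral_def)
qed

lemma abs_le_exp_abs: "\<bar>x\<bar> \<le> exp \<bar>x\<bar>" for x :: real
  using exp_ge_add_one_self[of "\<bar>x\<bar>"] by linarith

lemma norm_cexp_le: "cmod (exp z) \<le> exp (cmod z)"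
  by (simp add: abs_Re_le_cmod complex_Re_le_cmod)

text \<open>Both moments come from integrating a derivative that vanishes at infinity.\<close>
lemma gaussian_1d_moment1:
  fixes p :: complex
  assumes k: "k > 0"
  shows "has_bochner_integral lborel (\<lambda>x::real. x * exp (p * x - k * x\<^sup>2))
     (p / (2 * k) * (sqrt (pi / k) * exp (p\<^sup>2 / (4 * k))))"
proof -
  let ?g = "\<lambda>x::real. exp (p * x - k * x\<^sup>2)"
  let ?f = "\<lambda>x::real. p * ?g x - 2 * k * (x * ?g x)"
  have e: "exp (p * x - k * x\<^sup>2) = exp (- k * (norm x)\<^sup>2) *\<^sub>R exp (p * complex_of_real x)" for x :: real
    by (simp add: exp_diff exp_minus scaleR_conv_of_real exp_of_real[symmetric] field_simps)
  \<comment> \<open>Integrability of the moment has to come first, because the fundamental theorem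
    on the whole line asks for an integrable derivative. The factor x costs one extra unit of
    exponential rate.\<close>
  have "integrable lborel (\<lambda>x::real. exp (- k * (norm x)\<^sup>2) *\<^sub>R (complex_of_real x * exp (p * x)))"
  proof (rule integrable_gaussian_exp_growth[OF k, where C = 1 and D = "1 + cmod p"])
    show "norm (complex_of_real x * exp (p * x)) \<le> 1 * exp ((1 + cmod p) * norm x)" for x :: real
      using mult_mono[OF abs_le_exp_abs[of x] norm_cexp_le[of "p * x"]]
      by (simp add: norm_mult exp_add algebra_simps)
  qed simp
  then have int: "integrable lborel (\<lambda>x::real. x * exp (p * x - k * x\<^sup>2))"
    unfolding e by simp
  have "has_bochner_integral lborel ?f 0"
  proof (rule integral_derivative_eq_0[where F = "\<lambda>x::real. exp (p * x - k * x\<^sup>2)"])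
    show "((\<lambda>x::real. exp (p * x - k * x\<^sup>2)) has_vector_derivative ?f x) (at x)" for x
      unfolding of_real_mult of_real_power of_real_numeral of_real_diff of_real_1 of_real_minus
      by (rule has_vector_derivative_real_field)
         (auto intro!: derivative_eq_intros simp: algebra_simps)
    show "isCont ?f x" for x by (intro continuous_intros)
    show "integrable lborel ?f"
      using int gaussian_1d[OF k, of p]
      by (intro Bochner_Integration.integrable_diff integrable_mult_right) (auto simp: has_bochner_integral_iff)
    have "((\<lambda>x. exp (Re p * x - k * x\<^sup>2)) \<longlongrightarrow> 0) at_top" using k by real_asymp
    then show "(?g \<longlongrightarrow> 0) at_top"
      by (intro tendsto_norm_zero_cancel[of ?g]) simp
    have "((\<lambda>x. exp (Re p * x - k * x\<^sup>2)) \<longlongrightarrow> 0) at_bot" using k by real_asymp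
    then show "(?g \<longlongrightarrow> 0) at_bot"
      by (intro tendsto_norm_zero_cancel[of ?g]) simp
  qed
  \<comment> \<open>The integral of \<open>?f\<close> is 0 and that of \<open>?g\<close> is known,
    so the moment is found by solving the definition of \<open>?f\<close> for
    \<open>x * ?g x\<close>.\<close>
  then have "has_bochner_integral lborel (\<lambda>x. (p * exp (p * x - k * x\<^sup>2) - ?f x) / (2 * k))
    ((p * (sqrt (pi / k) * exp (p\<^sup>2 / (4 * k))) - 0) / (2 * k))"
    using gaussian_1d[OF k, of p]
    by (intro has_bochner_integral_divide has_bochner_integral_diff has_bochner_integral_mult_right) auto
  moreover have "(p * ?g x - ?f x) / (2 * k) = x * ?g x" for x :: real
    using k by simp
  ultimately show ?thesis by simp
qed

lemma gaussian_1d_moment2: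
  assumes k: "k > 0"
  shows "has_bochner_integral lborel (\<lambda>x::real. x\<^sup>2 * exp (- k * x\<^sup>2)) (1 / (2 * k) * sqrt (pi / k))"
proof -
  let ?f = "\<lambda>x::real. exp (- k * x\<^sup>2) - 2 * k * (x\<^sup>2 * exp (- k * x\<^sup>2))"
  have "integrable lborel (\<lambda>x::real. exp (- k * (norm x)\<^sup>2) *\<^sub>R x\<^sup>2)"
  proof (rule integrable_gaussian_exp_growth[OF k, where C = 1 and D = 2])
    show "norm (x\<^sup>2) \<le> 1 * exp (2 * norm x)" for x :: real
      using mult_mono[OF abs_le_exp_abs[of x] abs_le_exp_abs[of x]]
      by (simp add: power2_eq_square exp_add[symmetric])
  qed simp
  then have int: "integrable lborel (\<lambda>x::real. x\<^sup>2 * exp (- k * x\<^sup>2))"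
    by (simp add: mult.commute)
  have g: "has_bochner_integral lborel (\<lambda>x::real. exp (- k * x\<^sup>2)) (sqrt (pi / k))"
    by (rule gaussian_1d_real[OF k])
  have "has_bochner_integral lborel ?f 0"
  proof (rule integral_derivative_eq_0[where F = "\<lambda>x::real. x * exp (- k * x\<^sup>2)"])
    show "((\<lambda>x::real. x * exp (- k * x\<^sup>2)) has_vector_derivative ?f x) (at x)" for x
      unfolding has_real_derivative_iff_has_vector_derivative[symmetric]
      by (auto intro!: derivative_eq_intros simp: algebra_simps power2_eq_square)
    show "isCont ?f x" for x by (intro continuous_intros)
    show "integrable lborel ?f"
      using int g by (intro Bochner_Integration.integrable_diff integrable_mult_right) (auto simp: has_bochner_integral_iff)
    show "((\<lambda>x. x * exp (- k * x\<^sup>2)) \<longlongrightarrow> 0) at_top" using k by real_asymp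
    show "((\<lambda>x. x * exp (- k * x\<^sup>2)) \<longlongrightarrow> 0) at_bot" using k by real_asymp
  qed
  then have "has_bochner_integral lborel (\<lambda>x. (exp (- k * x\<^sup>2) - ?f x) / (2 * k))
    ((sqrt (pi / k) - 0) / (2 * k))"
    using g by (intro has_bochner_integral_divide has_bochner_integral_diff) auto
  moreover have "(exp (- k * x\<^sup>2) - ?f x) / (2 * k) = x\<^sup>2 * exp (- k * x\<^sup>2)" for x :: real
    using k by simp
  ultimately show ?thesis by simp
qed

text \<open>Only the factor of the coordinate \<open>c\<close> carries the weight \<open>h\<close>,
  and \<open>m\<close> is the ratio of the weighted to the plain one-dimensional integral. Keeping
  \<open>h\<close> arbitrary treats total mass, first and second moments together.\<close>

lemma gaussian_product:
  fixes p :: "'a::euclidean_space \<Rightarrow> complex"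
  assumes k: "k > 0" and c: "c \<in> Basis"
    and h: "has_bochner_integral lborel (\<lambda>x::real. h x * exp (p c * x - k * x\<^sup>2))
       (m * (sqrt (pi / k) * exp ((p c)\<^sup>2 / (4 * k))))"
  shows "has_bochner_integral lborel
    (\<lambda>v. h (v \<bullet> c) * exp ((\<Sum>b\<in>Basis. p b * (v \<bullet> b)) - k * (norm v)\<^sup>2))
    (m * (sqrt (pi / k) ^ DIM('a) * exp ((\<Sum>b\<in>Basis. (p b)\<^sup>2) / (4 * k))))"
proof -
  have "(\<Sum>b\<in>Basis. p b * (v \<bullet> b)) - k * (norm v)\<^sup>2 = (\<Sum>b\<in>Basis. p b * (v \<bullet> b) - k * (v \<bullet> b)\<^sup>2)" for v
    unfolding power2_norm_eq_inner
    by (simp add: euclidean_inner[of v v] sum_subtractf sum_distrib_left power2_eq_square)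
  moreover have "has_bochner_integral lborel
    (\<lambda>v::'a. \<Prod>b\<in>Basis. (\<lambda>x. (if b = c then h x else 1) * exp (p b * x - k * x\<^sup>2)) (v \<bullet> b))
    (\<Prod>b\<in>Basis. (if b = c then m else 1) * (sqrt (pi / k) * exp ((p b)\<^sup>2 / (4 * k))))"
    using h gaussian_1d[OF k] by (intro has_bochner_integral_lborel_prod) auto
  ultimately show ?thesis
    using c by (simp add: prod.distrib exp_sum sum_divide_distrib)
qed

section \<open>Gaussian integrals in complex coordinates\<close>

lemma Basis_vec_complex_sum:
  "(\<Sum>b\<in>(Basis :: (complex ^ 'n::finite) set). f b) = (\<Sum>k\<in>UNIV. f (axis k 1) + f (axis k \<i>))"
proof -
  have eq: "(Basis :: (complex ^ 'n) set) = (\<Union>k\<in>UNIV. {axis k 1, axis k \<i>})"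
    by (auto simp: Basis_vec_def Basis_complex_def)
  show ?thesis
    unfolding eq by (subst sum.UNION_disjoint) (auto simp: axis_eq_axis)
qed

lemma norm_vec_power2: "(norm v)\<^sup>2 = (\<Sum>k\<in>UNIV. (norm (v $ k))\<^sup>2)" for v :: "'a::real_normed_vector ^ 'n::finite"
  by (simp add: norm_vec_def L2_set_def sum_nonneg)

lemma bounded_bilinear_bil: "bounded_bilinear bil"
proof -
  have "bilinear bil"
    unfolding bilinear_def bil_def
    by (auto intro!: linearI simp: algebra_simps sum.distrib scaleR_sum_right)
  then show ?thesis by (simp add: bilinear_conv_bounded_bilinear)
qed

interpretation bil: bounded_bilinear bil
  by (rule bounded_bilinear_bil)

lemma norm_bil_le: "cmod (bil a v) \<le> norm a * norm v"
proof -
  have "cmod (bil a v) \<le> (\<Sum>k\<in>UNIV. \<bar>cmod (a $ k)\<bar> * \<bar>cmod (v $ k)\<bar>)"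
    unfolding bil_def by (rule order_trans[OF norm_sum]) (simp add: norm_mult)
  also have "\<dots> \<le> L2_set (\<lambda>k. cmod (a $ k)) UNIV * L2_set (\<lambda>k. cmod (v $ k)) UNIV"
    by (rule L2_set_mult_ineq)
  finally show ?thesis by (simp add: norm_vec_def)
qed

lemma cnjv_nth [simp]: "cnjv z $ k = cnj (z $ k)"
  by (simp add: cnjv_def)

lemma cnjv_cnjv [simp]: "cnjv (cnjv z) = z"
  by (simp add: vec_eq_iff)

lemma cnj_bil: "cnj (bil z w) = bil (cnjv z) (cnjv w)"
  by (simp add: bil_def)

lemma bil_cnjv_self: "bil v (cnjv v) = of_real ((norm v)\<^sup>2)"
  by (simp add: bil_def norm_vec_power2 complex_norm_square[symmetric])

lemma bounded_linear_cnjv: "bounded_linear (cnjv :: complex ^ 'n::finite \<Rightarrow> _)"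
  unfolding linear_conv_bounded_linear[symmetric]
  by (rule linearI) (auto simp: vec_eq_iff)

text \<open>The real directions \<open>axis k 1\<close> and \<open>axis k \<i>\<close> see the
  coefficients p_k + q_k and i (p_k - q_k), whose squares add up to 4 p_k q_k. Hence only the
  bilinear pairing of \<open>p\<close> with \<open>q\<close> survives in the exponent.\<close>

lemma gaussian_vec_product:
  fixes p q :: "complex ^ 'n::finite" and P :: "complex ^ 'n \<Rightarrow> complex"
  defines P: "P \<equiv> \<lambda>b. bil p b + bil q (cnjv b)"
  assumes k: "k > 0" and c: "c \<in> Basis"
    and h: "has_bochner_integral lborel (\<lambda>x::real. h x * exp (P c * x - k * x\<^sup>2))
       (m * (sqrt (pi / k) * exp ((P c)\<^sup>2 / (4 * k))))"
  shows "has_bochner_integral lborel (\<lambda>v. h (v \<bullet> c) * exp (bil p v + bil q (cnjv v) - k * (norm v)\<^sup>2))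
    (m * ((pi / k) ^ CARD('n) * exp (bil p q / k)))"
proof -
  interpret cnjv: bounded_linear "cnjv :: complex ^ 'n \<Rightarrow> _" by (rule bounded_linear_cnjv)
  have 1: "(\<Sum>b\<in>Basis. P b * (v \<bullet> b)) = bil p v + bil q (cnjv v)" for v
  proof -
    have "bil p v + bil q (cnjv v) = bil p (\<Sum>b\<in>Basis. (v \<bullet> b) *\<^sub>R b) + bil q (cnjv (\<Sum>b\<in>Basis. (v \<bullet> b) *\<^sub>R b))"
      by (simp add: euclidean_representation)
    also have "\<dots> = (\<Sum>b\<in>Basis. P b * (v \<bullet> b))"
      by (simp add: bil.sum_right cnjv.sum bil.scaleR_right cnjv.scaleR P sum.distrib scaleR_conv_of_real[where 'a = complex]
          algebra_simps)
    finally show ?thesis by simp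
  qed
  have ax: "bil r (axis j x) = r $ j * x" "cnjv (axis j x) = axis j (cnj x)" for r :: "complex ^ 'n" and j x
    by (auto simp: bil_def axis_def vec_eq_iff if_distrib cong: if_cong)
  have 2: "(\<Sum>b\<in>Basis. (P b)\<^sup>2) = 4 * bil p q"
    unfolding Basis_vec_complex_sum P ax
    unfolding bil_def sum_distrib_left
    by (intro sum.cong) (auto simp: power2_eq_square algebra_simps)
  have "sqrt (pi / k) ^ (2 * CARD('n)) = (pi / k) ^ CARD('n)"
    unfolding power_mult using k by simp
  then have 3: "sqrt (pi / k) ^ DIM(complex ^ 'n) = (pi / k) ^ CARD('n)"
    by (simp add: mult.commute)
  show ?thesis
    using gaussian_product[where p = P, OF k c h] unfolding 1 2 3 using k by simp
qed

lemma gaussian_vec: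
  fixes p q :: "complex ^ 'n::finite"
  assumes k: "k > 0"
  shows "has_bochner_integral lborel (\<lambda>v. exp (bil p v + bil q (cnjv v) - k * (norm v)\<^sup>2))
    ((pi / k) ^ CARD('n) * exp (bil p q / k))"
  using gaussian_vec_product[OF k SOME_Basis, where h = "\<lambda>_. 1" and m = 1] gaussian_1d[OF k] by simp

text \<open>The moments in the directions \<open>axis j 1\<close> and \<open>axis j \<i>\<close> are
  proportional to p_j + q_j and i (p_j - q_j). Recombining them to \<open>v $ j\<close> cancels p_j,
  and to its conjugate cancels q_j.\<close>

lemma gaussian_vec_moment1:
  fixes p q :: "complex ^ 'n::finite"
  assumes k: "k > 0"
  shows "has_bochner_integral lborel (\<lambda>v. v $ j * exp (bil p v + bil q (cnjv v) - k * (norm v)\<^sup>2))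
    (q $ j / k * ((pi / k) ^ CARD('n) * exp (bil p q / k)))"
    and "has_bochner_integral lborel (\<lambda>v. cnj (v $ j) * exp (bil p v + bil q (cnjv v) - k * (norm v)\<^sup>2))
    (p $ j / k * ((pi / k) ^ CARD('n) * exp (bil p q / k)))"
proof -
  let ?E = "\<lambda>v. exp (bil p v + bil q (cnjv v) - k * (norm v)\<^sup>2)" and ?I = "(pi / k) ^ CARD('n) * exp (bil p q / k)"
  have ax: "bil r (axis j x) = r $ j * x" "cnjv (axis j x) = axis j (cnj x)" for r :: "complex ^ 'n" and j x
    by (auto simp: bil_def axis_def vec_eq_iff if_distrib cong: if_cong)
  have B: "axis j 1 \<in> (Basis :: (complex ^ 'n) set)" "axis j \<i> \<in> (Basis :: (complex ^ 'n) set)"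
    by (auto simp: Basis_vec_def Basis_complex_def)
  have re: "has_bochner_integral lborel (\<lambda>v. (v \<bullet> axis j 1) * ?E v) ((p $ j + q $ j) / (2 * k) * ?I)"
    using gaussian_vec_product[OF k B(1), where h = "of_real" and p = p and q = q, OF gaussian_1d_moment1[OF k]]
    by (simp add: ax)
  have im: "has_bochner_integral lborel (\<lambda>v. (v \<bullet> axis j \<i>) * ?E v) ((p $ j * \<i> - q $ j * \<i>) / (2 * k) * ?I)"
    using gaussian_vec_product[OF k B(2), where h = "of_real" and p = p and q = q, OF gaussian_1d_moment1[OF k]]
    by (simp add: ax)
  have v: "v $ j = (v \<bullet> axis j 1) + \<i> * (v \<bullet> axis j \<i>)" "cnj (v $ j) = (v \<bullet> axis j 1) - \<i> * (v \<bullet> axis j \<i>)"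
    for v :: "complex ^ 'n"
    by (simp_all add: inner_axis complex_eq_iff)
  have "has_bochner_integral lborel (\<lambda>v. (v \<bullet> axis j 1) * ?E v + \<i> * ((v \<bullet> axis j \<i>) * ?E v))
     ((p $ j + q $ j) / (2 * k) * ?I + \<i> * ((p $ j * \<i> - q $ j * \<i>) / (2 * k) * ?I))"
    by (intro has_bochner_integral_add has_bochner_integral_mult_right re im)
  also have "(p $ j + q $ j) / (2 * k) * ?I + \<i> * ((p $ j * \<i> - q $ j * \<i>) / (2 * k) * ?I) = q $ j / k * ?I"
    using k by (simp add: field_simps)
  finally show "has_bochner_integral lborel (\<lambda>v. v $ j * ?E v) (q $ j / k * ?I)"
    unfolding v(1) by (simp add: algebra_simps)
  have "has_bochner_integral lborel (\<lambda>v. (v \<bullet> axis j 1) * ?E v - \<i> * ((v \<bullet> axis j \<i>) * ?E v))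
     ((p $ j + q $ j) / (2 * k) * ?I - \<i> * ((p $ j * \<i> - q $ j * \<i>) / (2 * k) * ?I))"
    by (intro has_bochner_integral_diff has_bochner_integral_mult_right re im)
  also have "(p $ j + q $ j) / (2 * k) * ?I - \<i> * ((p $ j * \<i> - q $ j * \<i>) / (2 * k) * ?I) = p $ j / k * ?I"
    using k by (simp add: field_simps)
  finally show "has_bochner_integral lborel (\<lambda>v. cnj (v $ j) * ?E v) (p $ j / k * ?I)"
    unfolding v(2) by (simp add: algebra_simps)
qed

text \<open>Stated for the centred Gaussian, the only exponential left in the Weyl integrand. The
  real and the imaginary direction of coordinate \<open>j\<close> contribute 1/(2k) each.\<close>

lemma gaussian_vec_moment2:
  assumes k: "k > 0"
  shows "has_bochner_integral lborel
    (\<lambda>v::complex ^ 'n::finite. of_real ((cmod (v $ j))\<^sup>2) * exp (- (k * (norm v)\<^sup>2) :: complex))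
    (1 / k * (pi / k) ^ CARD('n))"
proof -
  have B: "axis j 1 \<in> (Basis :: (complex ^ 'n) set)" "axis j \<i> \<in> (Basis :: (complex ^ 'n) set)"
    by (auto simp: Basis_vec_def Basis_complex_def)
  have z: "cnjv 0 = (0 :: complex ^ 'n)" by (simp add: vec_eq_iff)
  have "exp (- (k * x\<^sup>2) :: complex) = of_real (exp (- k * x\<^sup>2))" for x :: real
    unfolding exp_of_real[symmetric] by simp
  then have g: "has_bochner_integral lborel (\<lambda>x::real. of_real (x\<^sup>2) * exp (- (k * x\<^sup>2) :: complex))
      (of_real (1 / (2 * k) * sqrt (pi / k)))"
    using has_bochner_integral_of_real[OF gaussian_1d_moment2[OF k], where 'a = complex] by simp
  have *: "has_bochner_integral lborel
      (\<lambda>v::complex ^ 'n. of_real ((v \<bullet> c)\<^sup>2) * exp (- (k * (norm v)\<^sup>2) :: complex))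
      (1 / (2 * k) * ((pi / k) ^ CARD('n)))" if "c \<in> Basis" for c
    using gaussian_vec_product[OF k that, where h = "\<lambda>x. of_real (x\<^sup>2)" and p = 0 and q = 0 and m = "1 / (2 * k)"]
      g by (simp add: bil.zero_left)
  have "(cmod (v $ j))\<^sup>2 = (v \<bullet> axis j 1)\<^sup>2 + (v \<bullet> axis j \<i>)\<^sup>2" for v :: "complex ^ 'n"
    by (simp add: inner_axis cmod_power2)
  then have "has_bochner_integral lborel
      (\<lambda>v::complex ^ 'n. of_real ((cmod (v $ j))\<^sup>2) * exp (- (k * (norm v)\<^sup>2) :: complex))
      (1 / (2 * k) * ((pi / k) ^ CARD('n)) + 1 / (2 * k) * ((pi / k) ^ CARD('n)))"
    using has_bochner_integral_add[OF *[OF B(1)] *[OF B(2)]] by (simp add: algebra_simps)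
  then show ?thesis using k by (simp add: field_simps)
qed

lemma has_bochner_integral_mu:
  fixes f :: "complex ^ 'n::finite \<Rightarrow> 'b::{banach,second_countable_topology}"
  assumes "has_bochner_integral lborel f x" "lam > 0"
  shows "has_bochner_integral (mu lam) f ((lam / (2 * pi)) ^ CARD('n) *\<^sub>R x)"
  unfolding mu_def using assms borel_measurable_has_bochner_integral[OF assms(1)]
  by (intro has_bochner_integral_density has_bochner_integral_scaleR_right) auto

section \<open>One-parameter subgroups and the coadjoint action\<close>

lemma has_derivative_vec_lambda:
  fixes f :: "'n::finite \<Rightarrow> 'a::real_normed_vector \<Rightarrow> 'b::real_normed_vector"
  assumes "\<And>k. (f k has_derivative f' k) F"
  shows "((\<lambda>x. \<chi> k. f k x) has_derivative (\<lambda>h. \<chi> k. f' k h)) F"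
proof -
  have bl: "bounded_linear (axis k :: 'b \<Rightarrow> 'b ^ 'n)" for k
  proof (rule bounded_linear_intro[where K = 1])
    fix x :: 'b
    have "norm (axis k x :: 'b ^ 'n) \<le> (\<Sum>i\<in>UNIV. norm (if i = k then x else 0))"
      unfolding norm_vec_def axis_def by (simp add: L2_set_le_sum)
    then show "norm (axis k x :: 'b ^ 'n) \<le> norm x * 1"
      by (simp add: if_distrib[of norm] cong: if_cong)
  qed (auto simp: axis_def vec_eq_iff)
  have eq: "(\<chi> k. g k) = (\<Sum>k\<in>UNIV. axis k (g k :: 'b))" for g :: "'n \<Rightarrow> 'b"
    by (simp add: vec_eq_iff axis_def)
  show ?thesis
    unfolding eq
    by (intro has_derivative_sum bounded_linear.has_derivative[OF bl] assms)
qed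

lemma has_vector_derivative_vec_lambda:
  fixes f :: "'n::finite \<Rightarrow> real \<Rightarrow> 'b::real_normed_vector"
  assumes "\<And>k. (f k has_vector_derivative f' k) F"
  shows "((\<lambda>x. \<chi> k. f k x) has_vector_derivative (\<chi> k. f' k)) F"
proof -
  have "(\<lambda>h. h *\<^sub>R (\<chi> k. f' k)) = (\<lambda>h. \<chi> k. h *\<^sub>R f' k)" by (simp add: vec_eq_iff fun_eq_iff)
  with has_derivative_vec_lambda[of f "\<lambda>k h. h *\<^sub>R f' k" F] assms show ?thesis
    by (simp add: has_vector_derivative_def)
qed

text \<open>Recognises \<open>symp\<close> as the imaginary part of the Hermitian product, after
  which symplectic identities can be checked one coordinate at a time.\<close>

lemma symp_eq: "symp z w = (\<Sum>k\<in>UNIV. Im (cnj (z $ k) * w $ k))"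
proof -
  have "symp z w = (\<Sum>k\<in>UNIV. (Im (w $ k * cnj (z $ k)) - Im (z $ k * cnj (w $ k))) / 2)"
    by (simp add: symp_def bil_def cnjv_def sum_subtractf sum_divide_distrib[symmetric]
        sum_distrib_left[symmetric] mult.commute)
  also have "\<dots> = (\<Sum>k\<in>UNIV. Im (cnj (z $ k) * w $ k))"
    by (intro sum.cong) (auto simp: field_simps)
  finally show ?thesis .
qed

lemma bounded_bilinear_symp: "bounded_bilinear symp"
proof -
  have "bilinear symp"
    unfolding bilinear_def symp_eq
    by (auto intro!: linearI simp: algebra_simps sum.distrib sum_distrib_left sum_subtractf)
  then show ?thesis by (simp add: bilinear_conv_bounded_bilinear)
qed

interpretation symp: bounded_bilinear symp
  by (rule bounded_bilinear_symp)

lemma torus_act_nth: "torus_act \<alpha> t z $ k = exp (\<i> * complex_of_real (\<alpha> k t)) * z $ k"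
  by (simp add: torus_act_def)

lemma bounded_linear_torus_act: "bounded_linear (torus_act \<alpha> t)"
  unfolding linear_conv_bounded_linear[symmetric]
  by (rule linearI) (auto simp: vec_eq_iff torus_act_nth algebra_simps)

text \<open>Left translation is affine; this is its linear part.\<close>
definition left_lin :: "('n::finite \<Rightarrow> real ^ 'm::finite \<Rightarrow> real) \<Rightarrow>
    ('m, 'n) diamond \<Rightarrow> ('m, 'n) diamond \<Rightarrow> ('m, 'n) diamond"
  where "left_lin \<alpha> g X = (fst X, torus_act \<alpha> (fst g) (fst (snd X)),
     snd (snd X) + symp (fst (snd g)) (torus_act \<alpha> (fst g) (fst (snd X))) / 2)"

lemma diamond_mult_eq: "diamond_mult \<alpha> g h = g + left_lin \<alpha> g h"
  by (cases g; cases h) (simp add: left_lin_def)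

lemma bounded_linear_left_lin: "bounded_linear (left_lin \<alpha> g)"
proof -
  have "linear (left_lin \<alpha> g)"
    using linear_conv_bounded_linear bounded_linear_torus_act[of \<alpha> "fst g"]
    by (intro linearI) (auto simp: left_lin_def linear_simps symp.add_right symp.scaleR_right algebra_simps
        add_divide_distrib)
  then show ?thesis by (simp add: linear_conv_bounded_linear)
qed

text \<open>The condition under the \<open>THE\<close> of \<open>diamond_exp\<close>, with the group
  product unfolded to \<open>diamond_mult\<close>.\<close>

definition one_param :: "('n::finite \<Rightarrow> real ^ 'm::finite \<Rightarrow> real) \<Rightarrow>
    ('m, 'n) diamond \<Rightarrow> (real \<Rightarrow> ('m, 'n) diamond) \<Rightarrow> bool"
  where "one_param \<alpha> X \<gamma> \<longleftrightarrow> (\<forall>s s'. \<gamma> (s + s') = diamond_mult \<alpha> (\<gamma> s) (\<gamma> s')) \<and>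
    (\<gamma> has_vector_derivative X) (at 0)"

text \<open>An idempotent of a group is the identity: \<open>g = g + left_lin \<alpha> g g\<close>
  makes the torus coordinate vanish, then the vector, then the centre.\<close>

lemma one_param_0:
  assumes lin: "\<And>k. linear (\<alpha> k)" and "one_param \<alpha> X \<gamma>"
  shows "\<gamma> 0 = (0, 0, 0)"
proof -
  have "\<gamma> (0 + 0) = diamond_mult \<alpha> (\<gamma> 0) (\<gamma> 0)"
    using assms unfolding one_param_def by blast
  then have "left_lin \<alpha> (\<gamma> 0) (\<gamma> 0) = 0" by (simp add: diamond_mult_eq)
  moreover have "torus_act \<alpha> 0 z = z" for z
    using linear_0[OF lin] by (simp add: vec_eq_iff torus_act_nth)
  ultimately show ?thesis
    by (cases "\<gamma> 0") (auto simp: left_lin_def zero_prod_def symp.zero_right)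
qed

text \<open>The homomorphism law transports the velocity at 0 to time \<open>s\<close> by a left
  translation, which is affine and so contributes its linear part. This is the differential equation
  behind uniqueness.\<close>

lemma one_param_derivative:
  assumes "one_param \<alpha> X \<gamma>"
  shows "(\<gamma> has_vector_derivative left_lin \<alpha> (\<gamma> s) X) (at s)"
proof -
  have eq: "\<gamma> = (\<lambda>x. \<gamma> s + left_lin \<alpha> (\<gamma> s) (\<gamma> (x - s)))"
  proof
    fix x
    have "\<gamma> (s + (x - s)) = diamond_mult \<alpha> (\<gamma> s) (\<gamma> (x - s))"
      using assms unfolding one_param_def by blast
    then show "\<gamma> x = \<gamma> s + left_lin \<alpha> (\<gamma> s) (\<gamma> (x - s))" by (simp add: diamond_mult_eq)
  qed
  have "((\<lambda>x. x - s) has_vector_derivative 1) (at s)"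
    by (auto intro!: derivative_eq_intros)
  moreover have "(\<gamma> has_vector_derivative X) (at (s - s))"
    using assms by (simp add: one_param_def)
  ultimately have "(\<gamma> \<circ> (\<lambda>x. x - s) has_vector_derivative 1 *\<^sub>R X) (at s)"
    by (rule vector_diff_chain_at)
  then have "((\<lambda>x. \<gamma> s + left_lin \<alpha> (\<gamma> s) (\<gamma> (x - s))) has_vector_derivative left_lin \<alpha> (\<gamma> s) X) (at s)"
    using bounded_linear.has_vector_derivative[OF bounded_linear_left_lin[of \<alpha> "\<gamma> s"]]
      has_vector_derivative_add[OF has_vector_derivative_const]
    by (fastforce simp: o_def)
  then show ?thesis using eq by simp
qed

lemma eq_if_same_vector_derivative:
  fixes f g :: "real \<Rightarrow> 'a::real_normed_vector"
  assumes "\<And>s. (f has_vector_derivative D s) (at s)" "\<And>s. (g has_vector_derivative D s) (at s)"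
    and "f a = g a"
  shows "f = g"
proof
  fix s
  have "((\<lambda>x. f x - g x) has_derivative (\<lambda>h. 0)) (at x within UNIV)" for x
    using has_vector_derivative_diff[OF assms(1)[of x] assms(2)[of x]] by (simp add: has_vector_derivative_def)
  then obtain c where "\<And>x. f x - g x = c"
    using has_derivative_zero_constant[of UNIV "\<lambda>x. f x - g x"] by auto
  then show "f s = g s" using assms(3) by (metis cancel_comm_monoid_add_class.diff_cancel eq_iff_diff_eq_0)
qed

text \<open>
  The three components are compared in turn, since the velocity of each involves only the
  position in the preceding ones.
\<close>
lemma one_param_unique:
  assumes lin: "\<And>k. linear (\<alpha> k)" and \<gamma>: "one_param \<alpha> X \<gamma>" and \<delta>: "one_param \<alpha> X \<delta>"
  shows "\<gamma> = \<delta>"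
proof -
  have d: "((\<lambda>s. fst (\<gamma> s)) has_vector_derivative fst (left_lin \<alpha> (\<gamma> s) X)) (at s)"
    "((\<lambda>s. fst (snd (\<gamma> s))) has_vector_derivative fst (snd (left_lin \<alpha> (\<gamma> s) X))) (at s)"
    "((\<lambda>s. snd (snd (\<gamma> s))) has_vector_derivative snd (snd (left_lin \<alpha> (\<gamma> s) X))) (at s)"
    if "one_param \<alpha> X \<gamma>" for \<gamma> s
    using one_param_derivative[OF that, of s]
    by (auto intro!: bounded_linear.has_vector_derivative[OF bounded_linear_fst]
        bounded_linear.has_vector_derivative[OF bounded_linear_snd])
  have zero: "\<gamma> 0 = \<delta> 0" using one_param_0 assms by metis
  have 1: "(\<lambda>s. fst (\<gamma> s)) = (\<lambda>s. fst (\<delta> s))"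
    using d(1)[OF \<gamma>] d(1)[OF \<delta>] zero
    by (intro eq_if_same_vector_derivative[where a = 0]) (auto simp: left_lin_def)
  have 2: "(\<lambda>s. fst (snd (\<gamma> s))) = (\<lambda>s. fst (snd (\<delta> s)))"
    using d(2)[OF \<gamma>] d(2)[OF \<delta>] zero fun_cong[OF 1]
    by (intro eq_if_same_vector_derivative[where a = 0]) (auto simp: left_lin_def)
  have 3: "(\<lambda>s. snd (snd (\<gamma> s))) = (\<lambda>s. snd (snd (\<delta> s)))"
    using d(3)[OF \<gamma>] d(3)[OF \<delta>] zero fun_cong[OF 1] fun_cong[OF 2]
    by (intro eq_if_same_vector_derivative[where a = 0]) (auto simp: left_lin_def)
  show ?thesis
    using fun_cong[OF 1] fun_cong[OF 2] fun_cong[OF 3] by (auto intro!: prod_eqI)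
qed

text \<open>
  \<open>rot_int a s\<close> is the integral of \<open>exp (\<i> * r * a)\<close> over \<open>r\<close> from 0 to \<open>s\<close>, and \<open>area_int a s\<close> is
  the integral of \<open>Im (cnj (rot_int a r) * exp (\<i> * r * a))\<close>, i.e. twice the symplectic area swept
  out by the curve.
\<close>
definition rot_int :: "real \<Rightarrow> real \<Rightarrow> complex" where
  "rot_int a s = (if a = 0 then of_real s else (exp (\<i> * of_real (s * a)) - 1) / (\<i> * of_real a))"

definition area_int :: "real \<Rightarrow> real \<Rightarrow> real" where
  "area_int a s = (if a = 0 then 0 else (s - sin (s * a) / a) / a)"

text \<open>The integral up to \<open>s + s'\<close> splits at \<open>s\<close>, and the second
  piece starts rotated by the angle \<open>s * a\<close>. This is the cocycle law matching z + t.z'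
  in the group product.\<close>

lemma rot_int_add: "rot_int a (s + s') = rot_int a s + exp (\<i> * of_real (s * a)) * rot_int a s'"
  by (simp add: rot_int_def exp_add field_simps)

text \<open>The last term is the symplectic correction in the centre coordinate of the group
  product. After |exp(i s a)| = 1 is used, the identity reduces to the addition formula for the
  sine.\<close>

lemma area_int_add: "area_int a (s + s') = area_int a s + area_int a s'
    + Im (cnj (rot_int a s) * (exp (\<i> * of_real (s * a)) * rot_int a s'))"
proof (cases "a = 0")
  case False
  have e: "exp (\<i> * of_real x) = Complex (cos x) (sin x)" for x
    by (simp add: cis_conv_exp[symmetric] complex_eq_iff)
  have "cnj (rot_int a s) * (exp (\<i> * of_real (s * a)) * rot_int a s') =
    (cnj (exp (\<i> * of_real (s * a))) * exp (\<i> * of_real (s * a)) - exp (\<i> * of_real (s * a)))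
       * (exp (\<i> * of_real (s' * a)) - 1) / of_real (a * a)"
    using False by (simp add: rot_int_def field_simps)
  also have "cnj (exp (\<i> * of_real (s * a))) * exp (\<i> * of_real (s * a)) = 1"
    by (simp add: exp_cnj exp_add[symmetric])
  also have "Im ((1 - exp (\<i> * of_real (s * a))) * (exp (\<i> * of_real (s' * a)) - 1) / of_real (a * a)) =
     (sin (s * a) + sin (s' * a) - sin ((s + s') * a)) / (a * a)"
    unfolding e Im_divide_of_real by (simp add: distrib_right sin_add algebra_simps)
  finally have Im: "Im (cnj (rot_int a s) * (exp (\<i> * of_real (s * a)) * rot_int a s')) =
     (sin (s * a) + sin (s' * a) - sin ((s + s') * a)) / (a * a)" .
  show ?thesis unfolding Im using False by (simp add: area_int_def field_simps)
qed (simp add: rot_int_def area_int_def)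

lemma rot_int_derivative: "(rot_int a has_vector_derivative 1) (at 0)"
proof (cases "a = 0")
  case True
  then have "rot_int a = of_real" by (simp add: rot_int_def fun_eq_iff)
  then show ?thesis by (auto intro!: derivative_eq_intros)
next
  case False
  have "((\<lambda>z. (exp (\<i> * (z * of_real a)) - 1) / (\<i> * of_real a)) has_field_derivative 1) (at (of_real 0))"
    using False by (auto intro!: derivative_eq_intros)
  from has_vector_derivative_real_field[OF this] show ?thesis
    using False by (simp add: rot_int_def[abs_def])
qed

lemma area_int_derivative: "(area_int a has_vector_derivative 0) (at 0)"
  unfolding area_int_def[abs_def] has_real_derivative_iff_has_vector_derivative[symmetric]
  by (cases "a = 0") (auto intro!: derivative_eq_intros)

text \<open>The solution of the differential equation of \<open>one_param_derivative\<close>: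
  coordinate \<open>k\<close> integrates u_k rotating at speed \<open>\<alpha> k t\<close>, and the
  centre integrates c plus half the symplectic product of position and velocity.\<close>

definition diamond_curve :: "('n::finite \<Rightarrow> real ^ 'm::finite \<Rightarrow> real) \<Rightarrow>
    ('m, 'n) diamond \<Rightarrow> real \<Rightarrow> ('m, 'n) diamond"
  where "diamond_curve \<alpha> X s = (case X of (t, u, c) \<Rightarrow>
     (s *\<^sub>R t, \<chi> k. rot_int (\<alpha> k t) s * u $ k,
      s * c + (\<Sum>k\<in>UNIV. (cmod (u $ k))\<^sup>2 * area_int (\<alpha> k t) s) / 2))"

lemma one_param_diamond_curve:
  assumes lin: "\<And>k. linear (\<alpha> k)"
  shows "one_param \<alpha> X (diamond_curve \<alpha> X)"
proof -
  obtain t u c where X: "X = (t, u, c)" by (cases X)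
  have sc: "\<alpha> k (s *\<^sub>R t) = s * \<alpha> k t" for k s using lin by (simp add: linear_scale)
  have "diamond_curve \<alpha> X (s + s') = diamond_mult \<alpha> (diamond_curve \<alpha> X s) (diamond_curve \<alpha> X s')" for s s'
  proof -
    \<comment> \<open>Both pieces of the curve carry the same factor \<open>u $ k\<close>, so the
      symplectic term of the product is its squared modulus times the last term of
      \<open>area_int_add\<close>.\<close>
    have "Im (cnj (E * v) * (x * (E' * v))) = (cmod v)\<^sup>2 * Im (cnj E * (x * E'))" for E E' v x :: complex
    proof -
      have "cnj (E * v) * (x * (E' * v)) = complex_of_real ((cmod v)\<^sup>2) * (cnj E * (x * E'))"
        unfolding complex_norm_square by simp
      moreover have "Im (complex_of_real r * y) = r * Im y" for r y by simp
      ultimately show ?thesis by (simp only:)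
    qed
    then show ?thesis
      by (simp add: X diamond_curve_def scaleR_add_left vec_eq_iff torus_act_nth sc rot_int_add area_int_add
          symp_eq sum.distrib distrib_left distrib_right add_divide_distrib mult.assoc)
  qed
  moreover have "(diamond_curve \<alpha> X has_vector_derivative X) (at 0)"
  proof -
    have "((\<lambda>s. s *\<^sub>R t) has_vector_derivative t) (at 0)"
      by (auto intro!: derivative_eq_intros)
    moreover have "((\<lambda>s. \<chi> k. rot_int (\<alpha> k t) s * u $ k) has_vector_derivative (\<chi> k. 1 * u $ k)) (at 0)"
      by (intro has_vector_derivative_vec_lambda has_vector_derivative_mult_left rot_int_derivative)
    moreover have "((\<lambda>s. s * c + (\<Sum>k\<in>UNIV. (cmod (u $ k))\<^sup>2 * area_int (\<alpha> k t) s) / 2)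
        has_vector_derivative 1 * c + (\<Sum>k\<in>UNIV. (cmod (u $ k))\<^sup>2 * 0) / 2) (at 0)"
      by (intro has_vector_derivative_add has_vector_derivative_divide has_vector_derivative_sum
           has_vector_derivative_mult_right has_vector_derivative_mult_left area_int_derivative has_vector_derivative_id)
    ultimately show ?thesis
      unfolding X diamond_curve_def prod.case
      by (intro has_vector_derivative_eq_rhs[OF has_vector_derivative_Pair[OF _ has_vector_derivative_Pair]]) auto
  qed
  ultimately show ?thesis by (simp add: one_param_def)
qed

text \<open>The curve of \<open>X\<close> run at speed \<open>s\<close> is a one-parameter subgroup
  with velocity \<open>s *\<^sub>R X\<close>, and by uniqueness it is the one that the
  \<open>THE\<close> selects.\<close>

lemma diamond_exp_scaleR:
  assumes lin: "\<And>k. linear (\<alpha> k)"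
  shows "diamond_exp \<alpha> (s *\<^sub>R X) = diamond_curve \<alpha> X s"
proof -
  have "one_param \<alpha> (s *\<^sub>R X) (\<lambda>r. diamond_curve \<alpha> X (r * s))"
  proof -
    have "((\<lambda>r. r * s) has_vector_derivative s) (at 0)" by (auto intro!: derivative_eq_intros)
    moreover have "(diamond_curve \<alpha> X has_vector_derivative X) (at (0 * s))"
      using one_param_diamond_curve[of \<alpha>, OF lin] by (simp add: one_param_def)
    ultimately have "((\<lambda>r. diamond_curve \<alpha> X (r * s)) has_vector_derivative s *\<^sub>R X) (at 0)"
      using vector_diff_chain_at by (fastforce simp: o_def)
    then show ?thesis
      using one_param_diamond_curve[OF lin, where X = X] by (simp add: one_param_def distrib_right)
  qed
  moreover have "diamond_exp \<alpha> Y = (THE g. \<exists>\<gamma>. one_param \<alpha> Y \<gamma> \<and> g = \<gamma> 1)" for Y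
    by (simp add: diamond_exp_def one_param_def diamond_group_def conj_assoc)
  moreover have "(THE g. \<exists>\<gamma>. one_param \<alpha> (s *\<^sub>R X) \<gamma> \<and> g = \<gamma> 1) = diamond_curve \<alpha> X s"
  proof (rule the_equality)
    show "\<exists>\<gamma>. one_param \<alpha> (s *\<^sub>R X) \<gamma> \<and> diamond_curve \<alpha> X s = \<gamma> 1"
      using calculation(1) by (intro exI[of _ "\<lambda>r. diamond_curve \<alpha> X (r * s)"]) simp
    show "g = diamond_curve \<alpha> X s" if "\<exists>\<gamma>. one_param \<alpha> (s *\<^sub>R X) \<gamma> \<and> g = \<gamma> 1" for g
      using that one_param_unique[of \<alpha>, OF lin _ calculation(1)] by force
  qed
  ultimately show ?thesis by simp
qed

section \<open>Adjoint and coadjoint action\<close>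

lemma m_inv_diamond_group:
  assumes lin: "\<And>k. linear (\<alpha> k)"
  shows "m_inv (diamond_group \<alpha>) (t, z, c) = (- t, - torus_act \<alpha> (- t) z, - c)"
proof -
  interpret group "diamond_group \<alpha>" by (rule group_diamond_group[OF lin])
  have "symp (- w) w = 0" for w :: "complex ^ 'a" by (simp add: symp_eq)
  then show ?thesis
    by (intro inv_equality) (auto simp: diamond_group_def)
qed

text \<open>Conjugation by (t, z, c) sends (T, u, C) to a triple that involves T only through T and
  T.z, and the derivative of T.z at 0 is i alpha(T) z. In the centre, antisymmetry merges two halves
  of symp(z, t.U), and half of symp(z, i alpha(T) z) is the quadratic term.\<close>

lemma Ad_eq:
  fixes \<alpha> :: "'n::finite \<Rightarrow> real ^ 'm::finite \<Rightarrow> real"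
  assumes lin: "\<And>k. linear (\<alpha> k)"
  shows "Ad \<alpha> (t, z, c) (T, U, C) =
     (T, torus_act \<alpha> t U - (\<chi> k. \<i> * of_real (\<alpha> k T) * z $ k),
      C + symp z (torus_act \<alpha> t U) - (\<Sum>k\<in>UNIV. \<alpha> k T * (cmod (z $ k))\<^sup>2) / 2)"
proof -
  let ?G = "diamond_group \<alpha>" and ?ta = "torus_act \<alpha> t"
  interpret ta: bounded_linear ?ta by (rule bounded_linear_torus_act)
  have conj_eq: "(\<lambda>h. (t, z, c) \<otimes>\<^bsub>?G\<^esub> h \<otimes>\<^bsub>?G\<^esub> m_inv ?G (t, z, c)) =
    (\<lambda>h. (fst h, z + ?ta (fst (snd h)) - torus_act \<alpha> (fst h) z,
       snd (snd h) + symp z (?ta (fst (snd h))) / 2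
        + symp (z + ?ta (fst (snd h))) (- torus_act \<alpha> (fst h) z) / 2))"
  proof
    fix h :: "('m, 'n) diamond"
    obtain T u C where h: "h = (T, u, C)" by (cases h)
    have "torus_act \<alpha> (t + T) (- torus_act \<alpha> (- t) z) = - torus_act \<alpha> T z"
      using lin by (simp add: vec_eq_iff torus_act_nth linear_add linear_neg distrib_left exp_add exp_minus)
    then show "(t, z, c) \<otimes>\<^bsub>?G\<^esub> h \<otimes>\<^bsub>?G\<^esub> m_inv ?G (t, z, c) =
      (fst h, z + ?ta (fst (snd h)) - torus_act \<alpha> (fst h) z,
       snd (snd h) + symp z (?ta (fst (snd h))) / 2
        + symp (z + ?ta (fst (snd h))) (- torus_act \<alpha> (fst h) z) / 2)"
      by (simp add: m_inv_diamond_group[OF lin] h) (simp add: diamond_group_def)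
  qed
  have bl: "bounded_linear (\<alpha> k)" for k using lin by (simp add: linear_conv_bounded_linear)
  have tz: "((\<lambda>h. torus_act \<alpha> (fst h) z) has_derivative
      (\<lambda>h. \<chi> k. \<i> * of_real (\<alpha> k (fst h)) * z $ k)) (at (0 :: ('m, 'n) diamond))"
    unfolding torus_act_def
  proof (rule has_derivative_vec_lambda)
    fix k
    have "((\<lambda>h :: ('m, 'n) diamond. \<alpha> k (fst h)) has_derivative (\<lambda>h. \<alpha> k (fst h))) (at 0)"
      by (intro bounded_linear.has_derivative[OF bl] derivative_intros)
    then have "((\<lambda>h :: ('m, 'n) diamond. \<i> * complex_of_real (\<alpha> k (fst h))) has_derivative
       (\<lambda>h. \<i> * complex_of_real (\<alpha> k (fst h)))) (at 0)"
      by (intro derivative_intros)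
    \<comment> \<open>The outer function is differentiated at \<open>\<alpha> k 0 = 0\<close>, where
      the derivative of \<open>exp\<close> is the identity.\<close>
    from diff_chain_at[OF this, of exp "\<lambda>x. x"]
    have "((\<lambda>h :: ('m, 'n) diamond. exp (\<i> * complex_of_real (\<alpha> k (fst h)))) has_derivative
       (\<lambda>h. \<i> * complex_of_real (\<alpha> k (fst h)))) (at 0)"
      using linear_0[OF lin, of k]
        has_derivative_eq_rhs[OF DERIV_exp[of "0 :: complex", unfolded has_field_derivative_def], of "\<lambda>x. x"]
      by (simp add: o_def fun_eq_iff)
    then show "((\<lambda>h :: ('m, 'n) diamond. exp (\<i> * complex_of_real (\<alpha> k (fst h))) * z $ k) has_derivative
       (\<lambda>h. \<i> * complex_of_real (\<alpha> k (fst h)) * z $ k)) (at 0)"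
      by (intro has_derivative_mult_left)
  qed
  have u: "((\<lambda>h :: ('m, 'n) diamond. ?ta (fst (snd h))) has_derivative (\<lambda>h. ?ta (fst (snd h)))) (at 0)"
    by (intro ta.has_derivative derivative_intros)
  \<comment> \<open>Left unsimplified, so that it is literally what the derivative rules produce:
    the product rule for \<open>symp\<close> evaluates the undifferentiated factor at
    \<open>0\<close>.\<close>
  let ?D = "\<lambda>h. (fst h, 0 + ?ta (fst (snd h)) - (\<chi> k. \<i> * of_real (\<alpha> k (fst h)) * z $ k),
       snd (snd h) + symp z (?ta (fst (snd h))) / 2
        + (symp (z + ?ta (fst (snd (0 :: ('m, 'n) diamond)))) (- (\<chi> k. \<i> * of_real (\<alpha> k (fst h)) * z $ k)) +
           symp (0 + ?ta (fst (snd h))) (- torus_act \<alpha> (fst (0 :: ('m, 'n) diamond)) z)) / 2)"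
  have "((\<lambda>h. (fst h, z + ?ta (fst (snd h)) - torus_act \<alpha> (fst h) z,
       snd (snd h) + symp z (?ta (fst (snd h))) / 2
        + symp (z + ?ta (fst (snd h))) (- torus_act \<alpha> (fst h) z) / 2)) has_derivative ?D)
      (at (0 :: ('m, 'n) diamond))"
    by (intro has_derivative_Pair has_derivative_add has_derivative_diff has_derivative_const tz u
       bounded_linear.has_derivative[OF bounded_linear_divide] symp.FDERIV has_derivative_minus
       bounded_linear.has_derivative[OF symp.bounded_linear_right] has_derivative_fst has_derivative_snd has_derivative_ident)
  then have "Ad \<alpha> (t, z, c) = ?D"
    unfolding Ad_def conj_eq by (simp add: frechet_derivative_at[symmetric] diamond_group_def zero_prod_def)
  moreover have "torus_act \<alpha> 0 z = z"
    using linear_0[OF lin] by (simp add: vec_eq_iff torus_act_nth)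
  moreover have "symp (?ta U) z = - symp z (?ta U)"
    unfolding symp_eq sum_negf[symmetric] by (intro sum.cong) (auto simp: algebra_simps)
  moreover have "symp z (\<chi> k. \<i> * of_real (\<alpha> k T) * z $ k) = (\<Sum>k\<in>UNIV. \<alpha> k T * (cmod (z $ k))\<^sup>2)"
    unfolding symp_eq cmod_power2
    unfolding power2_eq_square by (intro sum.cong) (auto simp: algebra_simps)
  ultimately show ?thesis
    by (simp add: ta.zero symp.minus_right add_divide_distrib diff_divide_distrib)
qed

lemma surj_Ad:
  fixes \<alpha> :: "'n::finite \<Rightarrow> real ^ 'm::finite \<Rightarrow> real"
  assumes lin: "\<And>k. linear (\<alpha> k)"
  shows "surj (Ad \<alpha> g)"
  unfolding surj_def
proof
  obtain t z c where g: "g = (t, z, c)" by (cases g)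
  fix X :: "('m, 'n) diamond"
  obtain T U C where X: "X = (T, U, C)" by (cases X)
  \<comment> \<open>\<open>?W\<close> is the value that \<open>torus_act \<alpha> t\<close> must
    take for the vector component of \<open>Ad\<close> to come out as \<open>U\<close>.\<close>
  let ?W = "U + (\<chi> k. \<i> * of_real (\<alpha> k T) * z $ k)"
  have "torus_act \<alpha> t (torus_act \<alpha> (- t) ?W) = ?W"
    using lin by (simp add: vec_eq_iff torus_act_nth linear_neg exp_minus)
  then have "X = Ad \<alpha> g (T, torus_act \<alpha> (- t) ?W, C - symp z ?W + (\<Sum>k\<in>UNIV. \<alpha> k T * (cmod (z $ k))\<^sup>2) / 2)"
    by (simp add: g X Ad_eq[OF lin])
  then show "\<exists>Y. X = Ad \<alpha> g Y" by blast
qed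

text \<open>For a surjection \<open>inv_into\<close> is a right inverse, so it suffices to pull
  \<eta> back along the explicit map \<open>Ad \<alpha> g\<close>, which avoids a formula for its
  inverse.\<close>

lemma Ad_star_eqI:
  assumes lin: "\<And>k. linear (\<alpha> k)" and eq: "\<And>X. \<eta> (Ad \<alpha> g X) = \<xi> X"
  shows "Ad_star \<alpha> g \<xi> = \<eta>"
proof
  fix X
  have "Ad \<alpha> g (inv_into UNIV (Ad \<alpha> g) X) = X"
    using surj_f_inv_f[OF surj_Ad[of \<alpha>, OF lin]] .
  then show "Ad_star \<alpha> g \<xi> X = \<eta> X"
    unfolding Ad_star_def eq[symmetric] by simp
qed

text \<open>\<open>Ad\<close> fixes the torus coordinate, so any \<beta> is carried along unchanged;
  it will be -i d chi. The rest is quadratic: lam symp(t.z + w, i alpha(T) w) from the vector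
  component and -lam/2 sum alpha_k(T) |w_k|^2 from the centre together turn |(t.z + w)_k|^2 back
  into |(t.z)_k|^2 = |z_k|^2.\<close>

lemma Ad_star_dual_elem:
  fixes \<alpha> :: "'n::finite \<Rightarrow> real ^ 'm::finite \<Rightarrow> real"
  assumes lin: "\<And>k. linear (\<alpha> k)"
  shows "Ad_star \<alpha> g (dual_elem (\<lambda>t. \<beta> t + 1 / 2 * (\<Sum>k\<in>UNIV. (1 - lam * (cmod (z $ k))\<^sup>2) * \<alpha> k t)) (- (lam *\<^sub>R z)) lam) =
    dual_elem (\<lambda>t. \<beta> t + 1 / 2 * (\<Sum>k\<in>UNIV. (1 - lam * (cmod (diamond_act \<alpha> g z $ k))\<^sup>2) * \<alpha> k t))
      (- (lam *\<^sub>R diamond_act \<alpha> g z)) lam"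
proof (rule Ad_star_eqI[of \<alpha>, OF lin])
  fix X :: "('m, 'n) diamond"
  obtain t w c where g: "g = (t, w, c)" by (cases g)
  obtain T U C where X: "X = (T, U, C)" by (cases X)
  let ?z = "torus_act \<alpha> t z" and ?U = "torus_act \<alpha> t U"
  let ?v = "\<chi> k. \<i> * of_real (\<alpha> k T) * w $ k"
  have n: "(cmod (z $ k))\<^sup>2 = (cmod (?z $ k))\<^sup>2" for k
    by (simp add: torus_act_nth norm_mult)
  have S: "(\<Sum>k\<in>UNIV. (1 - lam * (cmod ((?z + w) $ k))\<^sup>2) * \<alpha> k T) / 2 + lam * symp (?z + w) ?v
      - lam * (\<Sum>k\<in>UNIV. \<alpha> k T * (cmod (w $ k))\<^sup>2) / 2 =
    (\<Sum>k\<in>UNIV. (1 - lam * (cmod (?z $ k))\<^sup>2) * \<alpha> k T) / 2"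
    unfolding symp_eq sum_distrib_left sum_divide_distrib sum.distrib[symmetric] sum_subtractf[symmetric]
    unfolding cmod_power2
    unfolding power2_eq_square
    by (intro sum.cong) (auto simp: field_simps)
  have A: "symp ?z ?U = symp z U" by (rule symp_torus_act)
  have B: "symp (- (lam *\<^sub>R z)) U = - lam * symp z U"
    by (simp add: symp.minus_left symp.scaleR_left)
  have D: "symp (- (lam *\<^sub>R (?z + w))) (?U - ?v) =
      - lam * symp ?z ?U - lam * symp w ?U + lam * symp (?z + w) ?v"
    by (simp add: symp.minus_left symp.scaleR_left symp.add_left symp.diff_right algebra_simps
      del: scaleR_add_right)
  \<comment> \<open>\<open>b\<close> stands for symp(w, t.U), which the vector and the centre
    component contribute with opposite signs; the premise is the identity \<open>S\<close>.\<close>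
  have alg: "s1 / 2 + (- lam * a - lam * b + lam * v) + (C + b - n / 2) * lam = s2 / 2 + - lam * a + C * lam"
    if "s1 / 2 + lam * v - lam * n / 2 = s2 / 2" for s1 s2 a b v n :: real
    using that by (simp add: algebra_simps)
  show "dual_elem (\<lambda>t. \<beta> t + 1 / 2 * (\<Sum>k\<in>UNIV. (1 - lam * (cmod (diamond_act \<alpha> g z $ k))\<^sup>2) * \<alpha> k t))
      (- (lam *\<^sub>R diamond_act \<alpha> g z)) lam (Ad \<alpha> g X) =
      dual_elem (\<lambda>t. \<beta> t + 1 / 2 * (\<Sum>k\<in>UNIV. (1 - lam * (cmod (z $ k))\<^sup>2) * \<alpha> k t)) (- (lam *\<^sub>R z)) lam X"
    using alg[OF S, of "symp z U" "symp w ?U"]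
    unfolding n g X dual_elem_def diamond_act.simps Ad_eq[of \<alpha>, OF lin] prod.case A B D by simp
qed

section \<open>Fock space\<close>

lemma exp_poly_growth:
  "cmod ((c + bil a v) * exp (bil b v)) \<le> (cmod c + norm a) * exp ((norm b + 1) * norm v)"
proof -
  have "cmod (c + bil a v) \<le> (cmod c + norm a) * exp (norm v)"
  proof -
    have "cmod (c + bil a v) \<le> cmod c * 1 + norm a * norm v"
      using norm_triangle_ineq[of c "bil a v"] norm_bil_le[of a v] by simp
    also have "\<dots> \<le> cmod c * exp (norm v) + norm a * exp (norm v)"
      using abs_le_exp_abs[of "norm v"] by (intro add_mono mult_left_mono) auto
    finally show ?thesis by (simp add: algebra_simps)
  qed
  moreover have "cmod (exp (bil b v)) \<le> exp (norm b * norm v)"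
    using norm_cexp_le[of "bil b v"] norm_bil_le[of b v] by (meson exp_le_cancel_iff order_trans)
  ultimately have "cmod (c + bil a v) * cmod (exp (bil b v)) \<le> (cmod c + norm a) * exp (norm v) * exp (norm b * norm v)"
    by (intro mult_mono) auto
  then show ?thesis unfolding norm_mult by (simp add: algebra_simps exp_add)
qed

lemma integrable_mu:
  fixes f :: "complex ^ 'n::finite \<Rightarrow> 'b::{banach,second_countable_topology}"
  assumes "integrable lborel f" "lam > 0"
  shows "integrable (mu lam) f"
  using has_bochner_integral_mu[OF has_bochner_integral_integrable[OF assms(1)] assms(2)]
  by (simp add: has_bochner_integral_iff)

lemma integrable_mu_growth:
  fixes f :: "complex ^ 'n::finite \<Rightarrow> complex"
  assumes lam: "lam > 0" and [measurable]: "f \<in> borel_measurable borel"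
    and le: "\<And>v. cmod (f v) \<le> C * exp (D * norm v)"
  shows "integrable (mu lam) (\<lambda>v. (cmod (f v))\<^sup>2 * exp (- lam * (norm v)\<^sup>2 / 2))"
proof -
  have "integrable lborel (\<lambda>v. exp (- (lam / 2) * (norm v)\<^sup>2) *\<^sub>R (cmod (f v))\<^sup>2)"
  proof (rule integrable_gaussian_exp_growth[where C = "C\<^sup>2" and D = "2 * D"])
    show "norm ((cmod (f v))\<^sup>2) \<le> C\<^sup>2 * exp (2 * D * norm v)" for v
      using power_mono[OF le[of v], of 2]
      by (simp add: power_mult_distrib exp_double[symmetric] mult.assoc)
  qed (use lam in auto)
  then show ?thesis using lam by (intro integrable_mu) (simp_all add: mult.commute)
qed

lemma bil_has_derivative: "(bil a has_derivative bil a) F"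
  by (rule bounded_linear_imp_has_derivative) (rule bil.bounded_linear_right)

lemma bil_scale: "bil a (c *s v) = c * bil a v"
  by (simp add: bil_def sum_distrib_left algebra_simps)

lemma continuous_on_bil: "continuous_on S (bil a)"
  by (rule linear_continuous_on) (rule bil.bounded_linear_right)

text \<open>This family contains the coherent states (c = 1, a = 0) as well as their images under
  the derived representation, which have an affine prefactor.\<close>

lemma exp_poly_in_fock_space:
  fixes a b :: "complex ^ 'n::finite"
  assumes lam: "lam > 0"
  shows "(\<lambda>v. (c + bil a v) * exp (bil b v)) \<in> fock_space lam"
proof -
  have "((\<lambda>v. (c + bil a v) * exp (bil b v)) has_derivative
      (\<lambda>h. (c + bil a v) * (exp (bil b v) * bil b h) + (0 + bil a h) * exp (bil b v))) (at v)" for v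
    using diff_chain_at[OF bil_has_derivative[of b] DERIV_exp[of "bil b v", unfolded has_field_derivative_def]]
    by (intro has_derivative_mult has_derivative_add has_derivative_const bil_has_derivative) (simp add: o_def)
  then have "holomorphic_vec (\<lambda>v. (c + bil a v) * exp (bil b v))"
    unfolding holomorphic_vec_def by (fastforce simp: bil_scale algebra_simps)
  moreover have "(\<lambda>v. (c + bil a v) * exp (bil b v)) \<in> borel_measurable borel"
    by (intro borel_measurable_continuous_onI continuous_intros continuous_on_bil)
  ultimately show ?thesis
    unfolding fock_space_def using integrable_mu_growth[OF lam _ exp_poly_growth] by blast
qed

lemma coherent_eq: "coherent lam w v = exp (bil ((lam / 2) *\<^sub>R cnjv w) v)"
  by (simp add: coherent_def bil.scaleR_left scaleR_conv_of_real[where 'a = complex])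

text \<open>The reproducing property. Conjugating the coherent state supplies q = (lam/2) z; at rate
  k = lam/2 the exponent bil b q / k is bil b z and the first moment q_j / k is z_j, so integrating
  amounts to evaluating at \<open>z\<close>. The total mass cancels the normalisation of
  \<open>mu\<close>.\<close>

lemma fock_inner_coherent:
  fixes a b z :: "complex ^ 'n::finite"
  assumes lam: "lam > 0"
  shows "fock_inner lam (\<lambda>v. (c + bil a v) * exp (bil b v)) (coherent lam z) = (c + bil a z) * exp (bil b z)"
proof -
  define q where "q = (lam / 2) *\<^sub>R z"
  have k: "lam / 2 > 0" using lam by simp
  let ?E = "\<lambda>v. exp (bil b v + bil q (cnjv v) - (lam / 2) * (norm v)\<^sup>2)"
  have eq: "(c + bil a v) * exp (bil b v) * cnj (coherent lam z v) * of_real (exp (- lam * (norm v)\<^sup>2 / 2)) =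
     c * ?E v + (\<Sum>j\<in>UNIV. a $ j * (v $ j * ?E v))" for v
  proof -
    have "cnj (coherent lam z v) = exp (bil q (cnjv v))"
      by (simp add: coherent_def q_def exp_cnj cnj_bil bil.scaleR_left scaleR_conv_of_real[where 'a = complex])
    then have "exp (bil b v) * cnj (coherent lam z v) * of_real (exp (- lam * (norm v)\<^sup>2 / 2)) = ?E v"
      by (simp add: exp_of_real[symmetric] exp_add[symmetric] algebra_simps)
    moreover have "(\<Sum>j\<in>UNIV. a $ j * (v $ j * ?E v)) = bil a v * ?E v"
      by (simp add: bil_def sum_distrib_right mult.assoc)
    ultimately show ?thesis by (simp add: algebra_simps)
  qed
  have "has_bochner_integral lborel (\<lambda>v. c * ?E v + (\<Sum>j\<in>UNIV. a $ j * (v $ j * ?E v)))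
     (c * ((pi / (lam / 2)) ^ CARD('n) * exp (bil b q / (lam / 2))) +
      (\<Sum>j\<in>UNIV. a $ j * (q $ j / (lam / 2) * ((pi / (lam / 2)) ^ CARD('n) * exp (bil b q / (lam / 2))))))"
    using gaussian_vec[OF k, of b q] gaussian_vec_moment1(1)[OF k, where p = b and q = q]
    by (intro has_bochner_integral_add has_bochner_integral_sum has_bochner_integral_mult_right) simp_all
  also have "c * ((pi / (lam / 2)) ^ CARD('n) * exp (bil b q / (lam / 2))) +
      (\<Sum>j\<in>UNIV. a $ j * (q $ j / (lam / 2) * ((pi / (lam / 2)) ^ CARD('n) * exp (bil b q / (lam / 2))))) =
      (pi / (lam / 2)) ^ CARD('n) *\<^sub>R ((c + bil a z) * exp (bil b z))"
  proof -
    have "q $ j / (lam / 2) = z $ j" for j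
      using lam by (simp add: q_def scaleR_conv_of_real[where 'a = complex])
    moreover have "bil b q / (lam / 2) = bil b z"
      using lam by (simp add: q_def bil.scaleR_right scaleR_conv_of_real[where 'a = complex])
    ultimately show ?thesis
      by (simp add: bil_def[of a] scaleR_conv_of_real sum_distrib_left sum_distrib_right algebra_simps)
  qed
  finally have "has_bochner_integral (mu lam) (\<lambda>v. c * ?E v + (\<Sum>j\<in>UNIV. a $ j * (v $ j * ?E v)))
     ((lam / (2 * pi)) ^ CARD('n) *\<^sub>R (pi / (lam / 2)) ^ CARD('n) *\<^sub>R ((c + bil a z) * exp (bil b z)))"
    by (rule has_bochner_integral_mu) (rule lam)
  moreover have "(lam / (2 * pi)) ^ CARD('n) * (pi / (lam / 2)) ^ CARD('n) = 1"
    using lam by (simp add: power_mult_distrib[symmetric])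
  ultimately show ?thesis
    unfolding fock_inner_def eq by (simp add: has_bochner_integral_iff)
qed

section \<open>Differentiating exponential families in the Fock norm\<close>

lemma has_vector_derivative_imp_quotient:
  assumes "(f has_vector_derivative f') (at 0)"
  shows "((\<lambda>s. (f s - f 0) /\<^sub>R s) \<longlongrightarrow> f') (at 0)"
proof -
  have "((\<lambda>s. norm (f s - f 0 - s *\<^sub>R f') / norm s) \<longlongrightarrow> 0) (at 0)"
    using assms by (simp add: has_vector_derivative_def has_derivative_iff_norm)
  moreover have "eventually (\<lambda>s. norm (f s - f 0 - s *\<^sub>R f') / norm s = norm ((f s - f 0) /\<^sub>R s - f')) (at 0)"
  proof (rule eventually_mono[OF eventually_neq_at_within[of 0]])
    fix s :: real assume s: "s \<noteq> 0"
    have "(f s - f 0) /\<^sub>R s - f' = (f s - f 0 - s *\<^sub>R f') /\<^sub>R s"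
      using s by (simp add: algebra_simps)
    then show "norm (f s - f 0 - s *\<^sub>R f') / norm s = norm ((f s - f 0) /\<^sub>R s - f')"
      by (simp add: divide_inverse mult.commute)
  qed
  ultimately have "((\<lambda>s. norm ((f s - f 0) /\<^sub>R s - f')) \<longlongrightarrow> 0) (at 0)"
    by (rule Lim_transform_eventually)
  then show ?thesis
    by (rule LIM_zero_cancel[OF tendsto_norm_zero_cancel])
qed

lemma has_vector_derivative_imp_lipschitz_at:
  assumes "(f has_vector_derivative f') (at 0)"
  shows "eventually (\<lambda>s. norm (f s - f 0) \<le> (norm f' + 1) * \<bar>s\<bar>) (at 0)"
proof -
  have "eventually (\<lambda>s. norm ((f s - f 0) /\<^sub>R s) < norm f' + 1) (at 0)"
    by (rule order_tendstoD(2)[OF tendsto_norm[OF has_vector_derivative_imp_quotient[OF assms]]]) simp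
  then show ?thesis
    using eventually_neq_at_within[of 0]
  proof eventually_elim
    case (elim s)
    have "norm (f s - f 0) = norm ((f s - f 0) /\<^sub>R s) * \<bar>s\<bar>"
      using elim(2) by simp
    also have "\<dots> \<le> (norm f' + 1) * \<bar>s\<bar>"
      using elim(1) by (intro mult_right_mono) auto
    finally show ?case .
  qed
qed

lemma cmod_exp_minus_one_le: "cmod (exp x - 1) \<le> cmod x * exp (cmod x)"
proof -
  have "cmod (exp x - exp 0) \<le> exp (cmod x) * cmod (x - 0)"
  proof (rule field_differentiable_bound[of "cball 0 (cmod x)" exp exp])
    show "cmod (exp z) \<le> exp (cmod x)" if "z \<in> cball 0 (cmod x)" for z
      using that by (intro order_trans[OF norm_cexp_le]) simp
  qed (auto intro: has_field_derivative_at_within DERIV_exp)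
  then show ?thesis by (simp add: mult.commute)
qed

text \<open>Supplies a majorant independent of \<open>s\<close>. Separating the change of the
  amplitude from that of the exponent yields two terms of order |s|, which cancels the division. In
  the rate, \<open>K\<close> covers the shift of the exponent, by |s| at most 1, and the extra 1
  pays for a factor \<open>norm z\<close>.\<close>

lemma exp_family_quotient_growth:
  fixes b b' :: "complex ^ 'n::finite" and s :: real
  assumes A: "cmod (a' - a) \<le> K * \<bar>s\<bar>" and B: "norm (b' - b) \<le> K * \<bar>s\<bar>" and s: "s \<noteq> 0" "\<bar>s\<bar> \<le> 1"
  shows "cmod ((a' * exp (bil b' z) - a * exp (bil b z)) / of_real s)
    \<le> K * (1 + cmod a) * exp ((norm b + K + 1) * norm z)"
proof -
  have "0 \<le> K * \<bar>s\<bar>" using A norm_ge_zero order_trans by blast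
  then have K: "K \<ge> 0" using s by (simp add: zero_le_mult_iff)
  have Ks: "K * \<bar>s\<bar> \<le> K" using K s by (simp add: mult_left_le)
  let ?z = "norm z"
  have e1: "cmod (exp (bil b z)) \<le> exp (norm b * ?z)"
    using norm_cexp_le[of "bil b z"] norm_bil_le[of b z] by (meson exp_le_cancel_iff order_trans)
  have d: "cmod (bil (b' - b) z) \<le> K * \<bar>s\<bar> * ?z"
    using norm_bil_le[of "b' - b" z] mult_right_mono[OF B, of ?z] by simp
  have d1: "cmod (bil (b' - b) z) \<le> K * ?z"
    using d mult_right_mono[OF Ks, of ?z] by simp
  have e3: "cmod (exp (bil (b' - b) z)) \<le> exp (K * ?z)"
    using norm_cexp_le[of "bil (b' - b) z"] d1 by (meson exp_le_cancel_iff order_trans)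
  have e4: "cmod (exp (bil (b' - b) z) - 1) \<le> K * \<bar>s\<bar> * ?z * exp (K * ?z)"
    using cmod_exp_minus_one_le[of "bil (b' - b) z"] mult_mono[OF d, of "exp (cmod (bil (b' - b) z))" "exp (K * ?z)"] d1 K
    by (auto intro: order_trans)
  have eq: "a' * exp (bil b' z) - a * exp (bil b z) =
    exp (bil b z) * ((a' - a) * exp (bil (b' - b) z) + a * (exp (bil (b' - b) z) - 1))"
    by (simp add: bil.diff_left exp_diff field_simps)
  have "cmod (a' * exp (bil b' z) - a * exp (bil b z)) \<le>
     exp (norm b * ?z) * (K * \<bar>s\<bar> * exp (K * ?z) + cmod a * (K * \<bar>s\<bar> * ?z * exp (K * ?z)))"
    unfolding eq norm_mult
  proof (intro mult_mono e1 order_trans[OF norm_triangle_ineq] add_mono)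
    show "cmod ((a' - a) * exp (bil (b' - b) z)) \<le> K * \<bar>s\<bar> * exp (K * ?z)"
      unfolding norm_mult by (rule mult_mono[OF A e3 \<open>0 \<le> K * \<bar>s\<bar>\<close>]) simp
    show "cmod (a * (exp (bil (b' - b) z) - 1)) \<le> cmod a * (K * \<bar>s\<bar> * ?z * exp (K * ?z))"
      unfolding norm_mult by (rule mult_left_mono[OF e4]) simp
  qed auto
  \<comment> \<open>\<open>?z\<close> is replaced by its exponential in one summand and 1 by the
    same exponential in the other, so that both acquire a common factor.\<close>
  also have "\<dots> \<le> exp (norm b * ?z) * (K * \<bar>s\<bar> * exp (K * ?z) * exp ?z + cmod a * (K * \<bar>s\<bar> * exp ?z * exp (K * ?z)))"
    using K abs_le_exp_abs[of ?z]
    by (intro mult_left_mono add_mono mult_right_mono order_trans[OF _ mult_left_mono[of 1 "exp ?z"]]) auto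
  also have "\<dots> = \<bar>s\<bar> * (K * (1 + cmod a) * exp ((norm b + K + 1) * ?z))"
    by (simp add: algebra_simps exp_add)
  finally show ?thesis using s by (simp add: norm_divide field_simps)
qed

lemma bil_scale_left: "bil (c *s a) v = c * bil a v"
  by (simp add: bil_def sum_distrib_left algebra_simps)

text \<open>The scalar \<open>A 0\<close> is moved into the vector so that the derivative again has
  the shape \<open>(c + bil a z) * exp (bil b z)\<close>.\<close>

lemma exp_family_vector_derivative:
  fixes B :: "real \<Rightarrow> complex ^ 'n::finite"
  assumes A: "(A has_vector_derivative A') (at 0)" and B: "(B has_vector_derivative B') (at 0)"
  shows "((\<lambda>s. A s * exp (bil (B s) z)) has_vector_derivative (A' + bil (A 0 *s B') z) * exp (bil (B 0) z)) (at 0)"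
proof -
  have "((\<lambda>s. bil (B s) z) has_vector_derivative bil B' z) (at 0)"
    by (rule bounded_linear.has_vector_derivative[OF bil.bounded_linear_left B])
  then have "(exp \<circ> (\<lambda>s. bil (B s) z) has_vector_derivative bil B' z * exp (bil (B 0) z)) (at 0)"
    by (rule field_vector_diff_chain_at) (rule DERIV_exp)
  from has_vector_derivative_mult[OF A this] show ?thesis
    by (simp add: o_def algebra_simps bil_scale_left)
qed

lemma exp_family_fock_derivative:
  fixes B :: "real \<Rightarrow> complex ^ 'n::finite"
  assumes lam: "lam > 0"
    and A: "(A has_vector_derivative A') (at 0)" and B: "(B has_vector_derivative B') (at 0)"
  shows "((\<lambda>s. fock_norm lam (\<lambda>z. (A s * exp (bil (B s) z) - A 0 * exp (bil (B 0) z)) / of_real s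
      - (A' + bil (A 0 *s B') z) * exp (bil (B 0) z))) \<longlongrightarrow> 0) (at 0)"
proof -
  define h where "h z = (A' + bil (A 0 *s B') z) * exp (bil (B 0) z)" for z
  define q where "q s z = (A s * exp (bil (B s) z) - A 0 * exp (bil (B 0) z)) / of_real s - h z" for s :: real and z
  define K where "K = max (cmod A' + 1) (norm B' + 1)"
  have "eventually (\<lambda>s. cmod (A s - A 0) \<le> K * \<bar>s\<bar> \<and> norm (B s - B 0) \<le> K * \<bar>s\<bar> \<and> \<bar>s\<bar> \<le> 1) (at 0)"
  proof -
    have "eventually (\<lambda>s::real. \<bar>s\<bar> < 1) (at 0)"
      by (rule order_tendstoD) (auto intro!: tendsto_eq_intros)
    then show ?thesis
      using has_vector_derivative_imp_lipschitz_at[OF A] has_vector_derivative_imp_lipschitz_at[OF B]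
    proof eventually_elim
      case (elim s)
      have "(cmod A' + 1) * \<bar>s\<bar> \<le> K * \<bar>s\<bar>" "(norm B' + 1) * \<bar>s\<bar> \<le> K * \<bar>s\<bar>"
        by (auto simp: K_def intro!: mult_right_mono)
      with elim show ?case by auto
    qed
  qed
  then obtain r where r: "r > 0"
    and near: "\<And>s. s \<noteq> 0 \<Longrightarrow> \<bar>s\<bar> < r \<Longrightarrow>
      cmod (A s - A 0) \<le> K * \<bar>s\<bar> \<and> norm (B s - B 0) \<le> K * \<bar>s\<bar> \<and> \<bar>s\<bar> \<le> 1"
    by (auto simp: eventually_at dist_real_def)
  define D where "D = norm (B 0) + K + 1"
  \<comment> \<open>The first summand bounds the difference quotient, the second the candidate
    derivative \<open>h\<close>; \<open>D\<close> dominates both rates.\<close>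
  define C where "C = K * (1 + cmod (A 0)) + (cmod A' + norm (A 0 *s B'))"
  have K: "K \<ge> 0" by (auto simp: K_def intro: order_trans[of _ "cmod A' + 1"])
  have bound: "cmod (q s z) \<le> C * exp (D * norm z)" if "s \<noteq> 0" "\<bar>s\<bar> < r" for s z
  proof -
    have "cmod (q s z) \<le> K * (1 + cmod (A 0)) * exp (D * norm z)
        + (cmod A' + norm (A 0 *s B')) * exp ((norm (B 0) + 1) * norm z)"
      unfolding q_def h_def D_def
      by (intro order_trans[OF norm_triangle_ineq4] add_mono exp_poly_growth
            exp_family_quotient_growth[OF _ _ that(1)] near[OF that, THEN conjunct1]
            near[OF that, THEN conjunct2, THEN conjunct1] near[OF that, THEN conjunct2, THEN conjunct2])
    moreover have "(cmod A' + norm (A 0 *s B')) * exp ((norm (B 0) + 1) * norm z)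
        \<le> (cmod A' + norm (A 0 *s B')) * exp (D * norm z)"
      using K by (intro mult_left_mono) (auto simp: D_def intro!: mult_right_mono)
    ultimately show ?thesis
      unfolding C_def distrib_right[of _ _ "exp (D * norm z)"] by linarith
  qed
  have [measurable]: "q s \<in> borel_measurable borel" for s
    unfolding q_def h_def divide_inverse
    by (intro borel_measurable_continuous_onI continuous_intros continuous_on_bil)
  have conv: "((\<lambda>s. q s z) \<longlongrightarrow> 0) (at 0)" for z
  proof -
    have "((\<lambda>s. (A s * exp (bil (B s) z) - A 0 * exp (bil (B 0) z)) /\<^sub>R s) \<longlongrightarrow> h z) (at 0)"
      using has_vector_derivative_imp_quotient[OF exp_family_vector_derivative[OF A B]] by (simp add: h_def)
    from LIM_zero[OF this] show ?thesis
      by (simp add: q_def scaleR_conv_of_real divide_inverse mult.commute)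
  qed
  let ?w = "\<lambda>z::complex ^ 'n. exp (- lam * (norm z)\<^sup>2 / 2)"
  have "C \<ge> 0" using K by (simp add: C_def)
  then have "integrable (mu lam) (\<lambda>z::complex ^ 'n. (cmod (of_real (C * exp (D * norm z))))\<^sup>2 * ?w z)"
    by (intro integrable_mu_growth[OF lam, where C = C and D = D]) (auto simp: norm_mult)
  then have dom: "integrable (mu lam) (\<lambda>z::complex ^ 'n. (C * exp (D * norm z))\<^sup>2 * ?w z)"
    unfolding norm_of_real power2_abs .
  have sets: "sets (mu lam :: (complex ^ 'n) measure) = sets borel" by (simp add: mu_def)
  \<comment> \<open>Dominated convergence concerns sequences, so the limit at 0 is tested along
    sequences in the punctured interval on which \<open>bound\<close> holds.\<close>
  have "((\<lambda>s. LINT z|mu lam. (cmod (q s z))\<^sup>2 * ?w z) \<longlongrightarrow> (LINT z|(mu lam :: (complex ^ 'n) measure). 0 :: real))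
      (at 0 within {-r<..<r})"
    unfolding tendsto_at_iff_sequentially
  proof (intro allI impI)
    fix X :: "nat \<Rightarrow> real"
    assume X: "\<forall>i. X i \<in> {-r<..<r} - {0}" and lim: "X \<longlonglongrightarrow> 0"
    have X': "filterlim X (at 0) sequentially"
      using X lim by (auto simp: filterlim_at)
    show "((\<lambda>s. LINT z|mu lam. (cmod (q s z))\<^sup>2 * ?w z) \<circ> X) \<longlonglongrightarrow> (LINT z|(mu lam :: (complex ^ 'n) measure). 0 :: real)"
      unfolding o_def
    proof (rule integral_dominated_convergence[where w = "\<lambda>z :: complex ^ 'n. (C * exp (D * norm z))\<^sup>2 * ?w z"])
      show "AE z in mu lam. (\<lambda>i. (cmod (q (X i) z))\<^sup>2 * ?w z) \<longlonglongrightarrow> 0"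
      proof (rule AE_I2)
        fix z :: "complex ^ 'n"
        have "(\<lambda>i. q (X i) z) \<longlonglongrightarrow> 0"
          using filterlim_compose[OF conv X'] .
        then have "(\<lambda>i. (cmod (q (X i) z))\<^sup>2 * ?w z) \<longlonglongrightarrow> (cmod 0)\<^sup>2 * ?w z"
          by (intro tendsto_intros)
        then show "(\<lambda>i. (cmod (q (X i) z))\<^sup>2 * ?w z) \<longlonglongrightarrow> 0" by simp
      qed
      show "AE z in mu lam. norm ((cmod (q (X i) z))\<^sup>2 * ?w z) \<le> (C * exp (D * norm z))\<^sup>2 * ?w z" for i
      proof (rule AE_I2)
        fix z :: "complex ^ 'n"
        have "cmod (q (X i) z) \<le> C * exp (D * norm z)"
          using X[rule_format, of i] by (intro bound) auto
        then show "norm ((cmod (q (X i) z))\<^sup>2 * ?w z) \<le> (C * exp (D * norm z))\<^sup>2 * ?w z"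
          by (simp add: power_mono)
      qed
      show "(\<lambda>z. (cmod (q (X i) z))\<^sup>2 * ?w z) \<in> borel_measurable (mu lam)" for i
        by (subst measurable_cong_sets[OF sets refl]) measurable
    qed (use dom in auto)
  qed
  then have "((\<lambda>s. LINT z|mu lam. (cmod (q s z))\<^sup>2 * ?w z) \<longlongrightarrow> 0) (at 0)"
    using r by (subst (asm) at_within_open) auto
  from tendsto_real_sqrt[OF this] show ?thesis
    unfolding fock_norm_def by (simp add: q_def h_def)
qed

section \<open>Uniqueness of the Fock derivative\<close>

lemma holomorphic_vec_continuous:
  assumes "holomorphic_vec f" shows "continuous_on UNIV f"
  using assms unfolding holomorphic_vec_def continuous_on_eq_continuous_within
  by (metis has_derivative_continuous)

lemma holomorphic_vec_diff:
  assumes "holomorphic_vec f" "holomorphic_vec g" shows "holomorphic_vec (\<lambda>z. f z - g z)"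
  unfolding holomorphic_vec_def
proof
  fix z
  from assms obtain D E where "(f has_derivative D) (at z)" "\<forall>a v. D (a *s v) = a * D v"
    "(g has_derivative E) (at z)" "\<forall>a v. E (a *s v) = a * E v"
    unfolding holomorphic_vec_def by meson
  then show "\<exists>D. ((\<lambda>z. f z - g z) has_derivative D) (at z) \<and> (\<forall>a v. D (a *s v) = a * D v)"
    by (intro exI[of _ "\<lambda>h. D h - E h"]) (auto intro: has_derivative_diff simp: algebra_simps)
qed

lemma holomorphic_vec_mult_left:
  assumes "holomorphic_vec f" shows "holomorphic_vec (\<lambda>z. c * f z)"
  unfolding holomorphic_vec_def
proof
  fix z
  from assms obtain D where "(f has_derivative D) (at z)" "\<forall>a v. D (a *s v) = a * D v"
    unfolding holomorphic_vec_def by meson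
  then show "\<exists>D. ((\<lambda>z. c * f z) has_derivative D) (at z) \<and> (\<forall>a v. D (a *s v) = a * D v)"
    by (intro exI[of _ "\<lambda>h. c * D h"]) (auto intro: has_derivative_mult_right simp: algebra_simps)
qed

lemma cmod_diff_power2_le: "(cmod (x - y))\<^sup>2 \<le> 2 * (cmod x)\<^sup>2 + 2 * (cmod y)\<^sup>2"
proof -
  have "(cmod (x - y))\<^sup>2 \<le> (cmod x + cmod y)\<^sup>2"
    by (intro power_mono norm_triangle_ineq4) simp
  also have "\<dots> \<le> 2 * (cmod x)\<^sup>2 + 2 * (cmod y)\<^sup>2"
    using sum_squares_bound[of "cmod x" "cmod y"] by (simp add: power2_sum)
  finally show ?thesis .
qed

lemma fock_space_mult_left: "f \<in> fock_space lam \<Longrightarrow> (\<lambda>z. c * f z) \<in> fock_space lam"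
  by (auto simp: fock_space_def norm_mult power_mult_distrib mult.assoc intro: holomorphic_vec_mult_left)

text \<open>One pointwise inequality gives both integrability and the norm estimate. The factor 2 is
  harmless, as the estimate serves only to force a norm to 0.\<close>

lemma fock_space_diff:
  fixes f g :: "complex ^ 'n::finite \<Rightarrow> complex"
  assumes f: "f \<in> fock_space lam" and g: "g \<in> fock_space lam"
  shows "(\<lambda>z. f z - g z) \<in> fock_space lam"
    and "(fock_norm lam (\<lambda>z. f z - g z))\<^sup>2 \<le> 2 * (fock_norm lam f)\<^sup>2 + 2 * (fock_norm lam g)\<^sup>2"
proof -
  let ?w = "\<lambda>z::complex ^ 'n. exp (- lam * (norm z)\<^sup>2 / 2)"
  have sets: "sets (mu lam :: (complex ^ 'n) measure) = sets borel" by (simp add: mu_def)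
  have hol: "holomorphic_vec (\<lambda>z. f z - g z)"
    using f g by (auto simp: fock_space_def intro: holomorphic_vec_diff)
  have fg: "integrable (mu lam) (\<lambda>z. 2 * ((cmod (f z))\<^sup>2 * ?w z) + 2 * ((cmod (g z))\<^sup>2 * ?w z))"
    using f g by (auto simp: fock_space_def)
  have le: "(cmod (f z - g z))\<^sup>2 * ?w z \<le> 2 * ((cmod (f z))\<^sup>2 * ?w z) + 2 * ((cmod (g z))\<^sup>2 * ?w z)" for z
    using mult_right_mono[OF cmod_diff_power2_le[of "f z" "g z"], of "?w z"] by (simp add: algebra_simps)
  have [measurable]: "(\<lambda>z. f z - g z) \<in> borel_measurable borel"
    using holomorphic_vec_continuous[OF hol] by (rule borel_measurable_continuous_onI)
  have int: "integrable (mu lam) (\<lambda>z. (cmod (f z - g z))\<^sup>2 * ?w z)"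
  proof (rule Bochner_Integration.integrable_bound[OF fg])
    show "(\<lambda>z. (cmod (f z - g z))\<^sup>2 * ?w z) \<in> borel_measurable (mu lam)"
      by (subst measurable_cong_sets[OF sets refl]) measurable
  qed (use le in \<open>auto simp: abs_le_iff intro: order_trans[OF _ le]\<close>)
  with hol show "(\<lambda>z. f z - g z) \<in> fock_space lam" by (simp add: fock_space_def)
  have "(LINT z|mu lam. (cmod (f z - g z))\<^sup>2 * ?w z) \<le>
     (LINT z|mu lam. 2 * ((cmod (f z))\<^sup>2 * ?w z) + 2 * ((cmod (g z))\<^sup>2 * ?w z))"
    by (rule integral_mono[OF int fg le])
  also have "\<dots> = 2 * (LINT z|mu lam. (cmod (f z))\<^sup>2 * ?w z) + 2 * (LINT z|mu lam. (cmod (g z))\<^sup>2 * ?w z)"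
    using f g by (simp add: fock_space_def)
  finally show "(fock_norm lam (\<lambda>z. f z - g z))\<^sup>2 \<le> 2 * (fock_norm lam f)\<^sup>2 + 2 * (fock_norm lam g)\<^sup>2"
    by (simp add: fock_norm_def)
qed

text \<open>Vanishing norm gives \<open>f z = 0\<close> almost everywhere; by continuity the
  exceptional set is open, and an open null set is empty.\<close>

lemma fock_norm_eq_0:
  fixes f :: "complex ^ 'n::finite \<Rightarrow> complex"
  assumes lam: "lam > 0" and f: "f \<in> fock_space lam" and "fock_norm lam f = 0"
  shows "f = (\<lambda>_. 0)"
proof -
  let ?w = "\<lambda>z::complex ^ 'n. exp (- lam * (norm z)\<^sup>2 / 2)"
  have cont: "continuous_on UNIV f"
    using f by (auto simp: fock_space_def intro: holomorphic_vec_continuous)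
  have "(LINT z|mu lam. (cmod (f z))\<^sup>2 * ?w z) = 0"
    using assms(3) by (simp add: fock_norm_def)
  then have "AE z in mu lam. (cmod (f z))\<^sup>2 * ?w z = 0"
    using f by (subst (asm) integral_nonneg_eq_0_iff_AE) (auto simp: fock_space_def)
  then have "AE z in lborel. f z = 0"
    using lam unfolding mu_def by (subst (asm) AE_density) auto
  moreover have op: "open {z. f z \<noteq> 0}"
    using cont open_Collect_neq[of f "\<lambda>_. 0"] by auto
  ultimately have "{z. f z \<noteq> 0} \<in> null_sets lborel"
    by (subst AE_iff_null_sets) auto
  then have "negligible {z. f z \<noteq> 0}"
    by (simp add: negligible_iff_null_sets null_sets_completionI)
  then have "{z. f z \<noteq> 0} = {}"
    using open_not_negligible[OF op] by blast
  then show ?thesis by auto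
qed

text \<open>The difference h1 - h2 is (q_s - h2) - (q_s - h1), and both terms tend to 0. The
  assumption \<open>rep\<close> keeps the quotients q_s in the Fock space, so that the norms are
  genuine: a Bochner integral of a non-integrable function is 0 by convention.\<close>

lemma has_drep_unique:
  fixes f h1 h2 :: "complex ^ 'n::finite \<Rightarrow> complex"
  assumes lam: "lam > 0" and h: "has_drep \<alpha> lam ch X f h1" "has_drep \<alpha> lam ch X f h2"
    and rep: "\<And>s::real. diamond_rep \<alpha> lam ch (diamond_exp \<alpha> (s *\<^sub>R X)) f \<in> fock_space lam"
  shows "h1 = h2"
proof -
  define q where "q s z = (diamond_rep \<alpha> lam ch (diamond_exp \<alpha> (s *\<^sub>R X)) f z - f z) / of_real s" for s :: real and z
  have f: "f \<in> fock_space lam" "h1 \<in> fock_space lam" "h2 \<in> fock_space lam"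
    using h by (auto simp: has_drep_def)
  have q: "q s \<in> fock_space lam" for s
    unfolding q_def divide_inverse
    using fock_space_mult_left[OF fock_space_diff(1)[OF rep[of s] f(1)], of "inverse (of_real s)"]
    by (simp add: mult.commute)
  have lim: "((\<lambda>s. fock_norm lam (\<lambda>z. q s z - h1 z)) \<longlongrightarrow> 0) (at 0)"
    "((\<lambda>s. fock_norm lam (\<lambda>z. q s z - h2 z)) \<longlongrightarrow> 0) (at 0)"
    using h by (auto simp: has_drep_def q_def)
  have "((\<lambda>s. 2 * (fock_norm lam (\<lambda>z. q s z - h2 z))\<^sup>2 + 2 * (fock_norm lam (\<lambda>z. q s z - h1 z))\<^sup>2)
     \<longlongrightarrow> 2 * 0\<^sup>2 + 2 * 0\<^sup>2) (at 0)"
    by (intro tendsto_intros lim)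
  moreover have "(fock_norm lam (\<lambda>z. h1 z - h2 z))\<^sup>2 \<le>
      2 * (fock_norm lam (\<lambda>z. q s z - h2 z))\<^sup>2 + 2 * (fock_norm lam (\<lambda>z. q s z - h1 z))\<^sup>2" for s
    using fock_space_diff(2)[OF fock_space_diff(1)[OF q[of s] f(3)] fock_space_diff(1)[OF q[of s] f(2)]]
    by simp
  ultimately have "(fock_norm lam (\<lambda>z. h1 z - h2 z))\<^sup>2 \<le> 2 * 0\<^sup>2 + 2 * 0\<^sup>2"
    by (intro tendsto_lowerbound[of _ _ "at (0::real)"]) auto
  then have "fock_norm lam (\<lambda>z. h1 z - h2 z) = 0" by simp
  from fock_norm_eq_0[OF lam fock_space_diff(1)[OF f(2,3)] this] show ?thesis
    by (simp add: fun_eq_iff)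
qed

section \<open>The derived representation and its Weyl symbol\<close>

lemma rot_int_0 [simp]: "rot_int a 0 = 0" and area_int_0 [simp]: "area_int a 0 = 0"
  by (simp_all add: rot_int_def area_int_def)

lemma unitary_character_0:
  assumes "unitary_character ch" shows "ch 0 = 1"
proof -
  have "ch (0 + 0) = ch 0 * ch 0" "cmod (ch 0) = 1"
    using assms unfolding unitary_character_def by blast+
  then show ?thesis by auto
qed

lemma has_derivative_along_line:
  assumes "(f has_derivative f') (at 0)"
  shows "((\<lambda>s. f (s *\<^sub>R t)) has_vector_derivative f' t) (at 0)"
proof -
  interpret f': bounded_linear f' by (rule has_derivative_bounded_linear[OF assms])
  have "((\<lambda>s::real. s *\<^sub>R t) has_derivative (\<lambda>h. h *\<^sub>R t)) (at 0)"
    by (auto intro!: derivative_eq_intros)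
  from diff_chain_at[OF this, of f f'] assms show ?thesis
    by (simp add: has_vector_derivative_def o_def f'.scaleR)
qed

text \<open>Differentiating \<open>ch x * cnj (ch x) = 1\<close> at 0 kills the real part of
  \<open>dch t\<close>.\<close>

lemma unitary_character_derivative_imaginary:
  assumes ch: "unitary_character ch" and d: "(ch has_derivative dch) (at 0)"
  shows "dch t = \<i> * of_real (Re (- \<i> * dch t))"
proof -
  have v: "((\<lambda>s. ch (s *\<^sub>R t)) has_vector_derivative dch t) (at 0)"
    by (rule has_derivative_along_line[OF d])
  have "((\<lambda>s. ch (s *\<^sub>R t) * cnj (ch (s *\<^sub>R t))) has_vector_derivative
      ch (0 *\<^sub>R t) * cnj (dch t) + dch t * cnj (ch (0 *\<^sub>R t))) (at 0)"
    by (intro has_vector_derivative_mult v bounded_linear.has_vector_derivative[OF bounded_linear_cnj])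
  moreover have "ch x * cnj (ch x) = 1" for x
    using ch by (simp add: unitary_character_def complex_norm_square[symmetric])
  ultimately have "((\<lambda>s::real. 1) has_vector_derivative cnj (dch t) + dch t) (at 0)"
    using unitary_character_0[OF ch] by simp
  then have "cnj (dch t) + dch t = 0"
    using has_vector_derivative_const vector_derivative_unique_at by blast
  then show ?thesis by (simp add: complex_eq_iff)
qed

text \<open>
  Writing \<open>exp (s X)\<close> for the one-parameter subgroup, the representation maps the coherent state
  at \<open>w\<close> to \<open>flow_scalar s * exp (bil (flow_vec s) z)\<close>.
\<close>
definition flow_scalar :: "('n::finite \<Rightarrow> real ^ 'm::finite \<Rightarrow> real) \<Rightarrow> real \<Rightarrow> (real ^ 'm \<Rightarrow> complex) \<Rightarrow>
    ('m, 'n) diamond \<Rightarrow> complex ^ 'n \<Rightarrow> real \<Rightarrow> complex"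
  where "flow_scalar \<alpha> lam ch X w s = (case X of (t, u, c) \<Rightarrow> ch (s *\<^sub>R t) *
     exp (\<i> * of_real (lam * (s * c + (\<Sum>k\<in>UNIV. (cmod (u $ k))\<^sup>2 * area_int (\<alpha> k t) s) / 2))
       - (\<Sum>k\<in>UNIV. of_real (lam / 4) * (rot_int (\<alpha> k t) s * u $ k * cnj (rot_int (\<alpha> k t) s * u $ k)))
       - (\<Sum>k\<in>UNIV. of_real (lam / 2) * (cnj (w $ k) * exp (- (\<i> * of_real (s * \<alpha> k t))) * (rot_int (\<alpha> k t) s * u $ k)))))"

definition flow_vec :: "('n::finite \<Rightarrow> real ^ 'm::finite \<Rightarrow> real) \<Rightarrow> real \<Rightarrow>
    ('m, 'n) diamond \<Rightarrow> complex ^ 'n \<Rightarrow> real \<Rightarrow> complex ^ 'n"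
  where "flow_vec \<alpha> lam X w s = (case X of (t, u, c) \<Rightarrow>
     \<chi> k. of_real (lam / 2) * (cnj (rot_int (\<alpha> k t) s * u $ k) + cnj (w $ k) * exp (- (\<i> * of_real (s * \<alpha> k t)))))"

text \<open>Exponents linear in \<open>z\<close> are collected in \<open>flow_vec\<close>, the
  others in \<open>flow_scalar\<close>. The last sum there comes from the shift of the argument
  inside the coherent state.\<close>

lemma diamond_rep_coherent:
  assumes lin: "\<And>k. linear (\<alpha> k)"
  shows "diamond_rep \<alpha> lam ch (diamond_exp \<alpha> (s *\<^sub>R X)) (coherent lam w) z =
    flow_scalar \<alpha> lam ch X w s * exp (bil (flow_vec \<alpha> lam X w s) z)"
proof -
  obtain t u c where X: "X = (t, u, c)" by (cases X)
  have neg: "\<alpha> k (- (s *\<^sub>R t)) = - (s * \<alpha> k t)" for k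
    using lin by (simp add: linear_neg linear_scale)
  let ?v = "\<chi> k. rot_int (\<alpha> k t) s * u $ k" and ?e = "\<lambda>k. exp (- (\<i> * of_real (s * \<alpha> k t)))"
  \<comment> \<open>Products with conjugates replace the squared norm, since the product rule
    applies to them directly.\<close>
  have norm: "complex_of_real (lam / 4 * (norm ?v)\<^sup>2) = (\<Sum>k\<in>UNIV. of_real (lam / 4) * (?v $ k * cnj (?v $ k)))"
    unfolding norm_vec_power2 complex_norm_square[symmetric] by (simp add: sum_distrib_left)
  have "of_real (lam / 2) * bil (cnjv ?v) z + of_real lam * bil (cnjv w) (torus_act \<alpha> (- (s *\<^sub>R t)) (z - ?v)) / 2 =
      bil (\<chi> k. of_real (lam / 2) * (cnj (rot_int (\<alpha> k t) s * u $ k) + cnj (w $ k) * ?e k)) z -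
      (\<Sum>k\<in>UNIV. of_real (lam / 2) * (cnj (w $ k) * ?e k * (rot_int (\<alpha> k t) s * u $ k)))"
    unfolding bil_def sum_distrib_left sum_divide_distrib sum.distrib[symmetric] sum_subtractf[symmetric]
    by (intro sum.cong) (auto simp: torus_act_nth neg field_simps)
  moreover have "C * exp (a + b - n) * exp e = C * exp (a - n - r) * exp f" if "b + e = f - r"
    for a b e f n r C :: complex
  proof -
    have "f = b + e + r" using that by simp
    then show ?thesis by (simp add: mult.assoc exp_add[symmetric] add_diff_eq[symmetric] add.assoc)
     (simp add: algebra_simps)
  qed
  ultimately show ?thesis
    unfolding diamond_exp_scaleR[of \<alpha>, OF lin] diamond_curve_def X prod.case diamond_rep.simps flow_scalar_def
      flow_vec_def coherent_def norm vec_lambda_beta by blast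
qed

lemma flow_0:
  assumes "unitary_character ch"
  shows "flow_scalar \<alpha> lam ch X w 0 = 1" "flow_vec \<alpha> lam X w 0 = (lam / 2) *\<^sub>R cnjv w"
  using unitary_character_0[OF assms]
  by (simp_all add: flow_scalar_def flow_vec_def vec_eq_iff scaleR_conv_of_real[where 'a = complex] split: prod.split)

lemma exp_rotation_derivative:
  "((\<lambda>s. exp (- (\<i> * of_real (s * a)))) has_vector_derivative - (\<i> * of_real a)) (at (0::real))"
proof -
  have "((\<lambda>z. exp (- (\<i> * (z * of_real a)))) has_field_derivative - (\<i> * of_real a)) (at (of_real 0))"
    by (auto intro!: derivative_eq_intros)
  from has_vector_derivative_real_field[OF this] show ?thesis by simp
qed

lemma flow_vec_derivative:
  "(flow_vec \<alpha> lam (t, u, c) w has_vector_derivative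
     (\<chi> k. of_real (lam / 2) * (cnj (u $ k) - \<i> * of_real (\<alpha> k t) * cnj (w $ k)))) (at 0)"
proof -
  have "((\<lambda>s. of_real (lam / 2) * (cnj (rot_int (\<alpha> k t) s * u $ k) + cnj (w $ k) * exp (- (\<i> * of_real (s * \<alpha> k t)))))
     has_vector_derivative of_real (lam / 2) * (cnj (1 * u $ k) + cnj (w $ k) * - (\<i> * of_real (\<alpha> k t)))) (at 0)" for k
    by (intro has_vector_derivative_mult_right has_vector_derivative_add has_vector_derivative_mult_left
        bounded_linear.has_vector_derivative[OF bounded_linear_cnj] rot_int_derivative exp_rotation_derivative)
  from has_vector_derivative_vec_lambda[OF this] show ?thesis
    by (simp add: flow_vec_def[abs_def] algebra_simps)
qed

text \<open>At \<open>s = 0\<close> the curve passes through \<open>rot_int = 0\<close>, so the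
  quadratic sum and the rotation acting on \<open>w\<close> drop out, and the area term has
  derivative 0. What remains is linear in (t, u, c).\<close>

lemma flow_scalar_derivative:
  assumes ch: "unitary_character ch" and d: "(ch has_derivative dch) (at 0)"
  shows "(flow_scalar \<alpha> lam ch (t, u, c) w has_vector_derivative
     dch t + \<i> * of_real (lam * c) - of_real (lam / 2) * bil (cnjv w) u) (at 0)"
proof -
  let ?r = "\<lambda>k s. rot_int (\<alpha> k t) s * u $ k" and ?e = "\<lambda>k s. exp (- (\<i> * of_real (s * \<alpha> k t)))"
  let ?E = "\<lambda>s. \<i> * of_real (lam * (s * c + (\<Sum>k\<in>UNIV. (cmod (u $ k))\<^sup>2 * area_int (\<alpha> k t) s) / 2))
       - (\<Sum>k\<in>UNIV. of_real (lam / 4) * (?r k s * cnj (?r k s)))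
       - (\<Sum>k\<in>UNIV. of_real (lam / 2) * (cnj (w $ k) * ?e k s * ?r k s))"
  have r: "(?r k has_vector_derivative 1 * u $ k) (at 0)" for k
    by (intro has_vector_derivative_mult_left rot_int_derivative)
  have "(?E has_vector_derivative
      \<i> * of_real (lam * (1 * c + (\<Sum>k\<in>UNIV. (cmod (u $ k))\<^sup>2 * 0) / 2))
       - (\<Sum>k\<in>UNIV. of_real (lam / 4) * (?r k 0 * cnj (1 * u $ k) + (1 * u $ k) * cnj (?r k 0)))
       - (\<Sum>k\<in>UNIV. of_real (lam / 2) * (cnj (w $ k) * ?e k 0 * (1 * u $ k) + (cnj (w $ k) * - (\<i> * of_real (\<alpha> k t))) * ?r k 0))) (at 0)"
    by (intro has_vector_derivative_diff has_vector_derivative_sum has_vector_derivative_mult_right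
        has_vector_derivative_mult r bounded_linear.has_vector_derivative[OF bounded_linear_cnj]
        bounded_linear.has_vector_derivative[OF bounded_linear_of_real] has_vector_derivative_add
        has_vector_derivative_divide has_vector_derivative_mult_left has_vector_derivative_id
        area_int_derivative exp_rotation_derivative)
  then have "(?E has_vector_derivative \<i> * of_real (lam * c) - of_real (lam / 2) * bil (cnjv w) u) (at 0)"
    by (simp add: bil_def sum_distrib_left)
  from field_vector_diff_chain_at[OF this DERIV_exp]
  have "((\<lambda>s. exp (?E s)) has_vector_derivative \<i> * of_real (lam * c) - of_real (lam / 2) * bil (cnjv w) u) (at 0)"
    by (simp add: o_def)
  from has_vector_derivative_mult[OF has_derivative_along_line[OF d, of t] this] show ?thesis
    using unitary_character_0[OF ch] by (simp add: flow_scalar_def[abs_def] algebra_simps)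
qed

lemma drep_coherent:
  fixes \<alpha> :: "'n::finite \<Rightarrow> real ^ 'm::finite \<Rightarrow> real"
  assumes lin: "\<And>k. linear (\<alpha> k)" and lam: "lam > 0"
    and ch: "unitary_character ch" and d: "(ch has_derivative dch) (at 0)"
  shows "drep \<alpha> lam ch (t, u, c) (coherent lam w) =
    (\<lambda>v. (dch t + \<i> * of_real (lam * c) - of_real (lam / 2) * bil (cnjv w) u
        + bil (\<chi> k. of_real (lam / 2) * (cnj (u $ k) - \<i> * of_real (\<alpha> k t) * cnj (w $ k))) v)
      * exp (bil ((lam / 2) *\<^sub>R cnjv w) v))"
    (is "_ = ?h")
proof -
  let ?X = "(t, u, c)"
  have exp_in: "(\<lambda>v. a * exp (bil b v)) \<in> fock_space lam" for a and b :: "complex ^ 'n"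
    using exp_poly_in_fock_space[OF lam, of a 0 b] by (simp add: bil.zero_left)
  have rep: "diamond_rep \<alpha> lam ch (diamond_exp \<alpha> (s *\<^sub>R ?X)) (coherent lam w) =
      (\<lambda>z. flow_scalar \<alpha> lam ch ?X w s * exp (bil (flow_vec \<alpha> lam ?X w s) z))" for s
    by (rule ext) (rule diamond_rep_coherent[OF lin])
  have coh: "coherent lam w = (\<lambda>z. 1 * exp (bil ((lam / 2) *\<^sub>R cnjv w) z))"
    by (rule ext) (simp add: coherent_eq)
  have lim: "((\<lambda>s. fock_norm lam (\<lambda>z. (diamond_rep \<alpha> lam ch (diamond_exp \<alpha> (s *\<^sub>R ?X)) (coherent lam w) z
      - coherent lam w z) / of_real s - ?h z)) \<longlongrightarrow> 0) (at 0)"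
    using exp_family_fock_derivative[OF lam flow_scalar_derivative[OF ch d, of \<alpha> lam t u c w]
        flow_vec_derivative[of \<alpha> lam t u c w]]
    unfolding rep unfolding flow_0[OF ch] coh by simp
  have has: "has_drep \<alpha> lam ch ?X (coherent lam w) ?h"
    unfolding has_drep_def
    using exp_in[of 1 "(lam / 2) *\<^sub>R cnjv w"] exp_poly_in_fock_space[OF lam] lim by (simp add: coh)
  moreover have "h = ?h" if "has_drep \<alpha> lam ch ?X (coherent lam w) h" for h
    by (rule has_drep_unique[OF lam that has]) (unfold rep, rule exp_in)
  ultimately show ?thesis unfolding drep_def by (rule the_equality)
qed

section \<open>The Weyl symbol of the derived representation\<close>

lemma weyl_integrand_drep:
  fixes \<alpha> :: "'n::finite \<Rightarrow> real ^ 'm::finite \<Rightarrow> real" and z w :: "complex ^ 'n"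
  assumes lin: "\<And>k. linear (\<alpha> k)" and lam: "lam > 0"
    and ch: "unitary_character ch" and d: "(ch has_derivative dch) (at 0)"
  shows "weyl_integrand lam (drep \<alpha> lam ch (t, u, c)) z w =
    (dch t + \<i> * of_real (lam * c)
      + (\<Sum>k\<in>UNIV. of_real (lam / 2) * (cnj (u $ k) * z $ k - cnj (z $ k) * u $ k)
          - \<i> * of_real (lam / 2 * \<alpha> k t) * (z $ k * cnj (z $ k)))) * exp (- (lam * (norm w)\<^sup>2) :: complex)
    + (\<Sum>k\<in>UNIV. of_real (lam / 2) * (cnj (u $ k) - \<i> * of_real (\<alpha> k t) * cnj (z $ k)) * (w $ k * exp (- (lam * (norm w)\<^sup>2) :: complex))
        + of_real (lam / 2) * (u $ k + \<i> * of_real (\<alpha> k t) * z $ k) * (cnj (w $ k) * exp (- (lam * (norm w)\<^sup>2) :: complex))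
        + \<i> * of_real (lam / 2 * \<alpha> k t) * (of_real ((cmod (w $ k))\<^sup>2) * exp (- (lam * (norm w)\<^sup>2) :: complex)))"
proof -
  let ?E = "exp (- (lam * (norm w)\<^sup>2) :: complex)"
  interpret cnjv: bounded_linear "cnjv :: complex ^ 'n \<Rightarrow> _" by (rule bounded_linear_cnjv)
  have comm: "bil a b = bil b a" for a b :: "complex ^ 'n" by (simp add: bil_def mult.commute)
  \<comment> \<open>Sorts the affine prefactor of the kernel at (z + w, z - w) by its type in
    \<open>w\<close>: constant, w_k, conjugate of w_k, |w_k|^2. The product of conj(z - w)_k with (z
    + w)_k makes the last coefficient positive.\<close>
  have expand: "bil (\<chi> k. of_real (lam / 2) * (cnj (u $ k) - \<i> * of_real (\<alpha> k t) * cnj ((z - w) $ k))) (z + w)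
      - of_real (lam / 2) * bil (cnjv (z - w)) u =
    (\<Sum>k\<in>UNIV. of_real (lam / 2) * (cnj (u $ k) * z $ k - cnj (z $ k) * u $ k)
          - \<i> * of_real (lam / 2 * \<alpha> k t) * (z $ k * cnj (z $ k))) +
    (\<Sum>k\<in>UNIV. of_real (lam / 2) * (cnj (u $ k) - \<i> * of_real (\<alpha> k t) * cnj (z $ k)) * w $ k
        + of_real (lam / 2) * (u $ k + \<i> * of_real (\<alpha> k t) * z $ k) * cnj (w $ k)
        + \<i> * of_real (lam / 2 * \<alpha> k t) * of_real ((cmod (w $ k))\<^sup>2))"
    unfolding complex_norm_square bil_def sum_distrib_left sum.distrib[symmetric] sum_subtractf[symmetric]
    by (intro sum.cong) (simp_all add: field_simps)
  have shift: "p - x + y = p + s1 + s2" if "y - x = s1 + s2" for p x y s1 s2 :: complex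
    using that by (simp add: algebra_simps)
  \<comment> \<open>The reproducing kernel contributes conj(z - w)(z + w) = |z|^2 - |w|^2 plus cross
    terms; the Weyl factor cancels |z|^2 and the cross terms and doubles -|w|^2.\<close>
  have "exp (bil ((lam / 2) *\<^sub>R cnjv (z - w)) (z + w)) *
      exp (of_real (lam / 2) * (- bil z (cnjv z) - bil w (cnjv w) + bil z (cnjv w) - bil (cnjv z) w)) = ?E"
    unfolding exp_add[symmetric]
    by (simp add: bil.scaleR_left bil_cnjv_self[of w] scaleR_conv_of_real[where 'a = complex] cnjv.diff bil.diff_left bil.add_right comm[of "cnjv z"]
         comm[of "cnjv w"] algebra_simps)
  then have "weyl_integrand lam (drep \<alpha> lam ch (t, u, c)) z w =
    (dch t + \<i> * of_real (lam * c) - of_real (lam / 2) * bil (cnjv (z - w)) u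
        + bil (\<chi> k. of_real (lam / 2) * (cnj (u $ k) - \<i> * of_real (\<alpha> k t) * cnj ((z - w) $ k))) (z + w)) * ?E"
    unfolding weyl_integrand_def berezin_kernel_def drep_coherent[of \<alpha>, OF assms] fock_inner_coherent[OF lam]
    by (simp add: mult.assoc)
  also have "dch t + \<i> * of_real (lam * c) - of_real (lam / 2) * bil (cnjv (z - w)) u
        + bil (\<chi> k. of_real (lam / 2) * (cnj (u $ k) - \<i> * of_real (\<alpha> k t) * cnj ((z - w) $ k))) (z + w) =
     dch t + \<i> * of_real (lam * c)
      + (\<Sum>k\<in>UNIV. of_real (lam / 2) * (cnj (u $ k) * z $ k - cnj (z $ k) * u $ k)
          - \<i> * of_real (lam / 2 * \<alpha> k t) * (z $ k * cnj (z $ k)))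
      + (\<Sum>k\<in>UNIV. of_real (lam / 2) * (cnj (u $ k) - \<i> * of_real (\<alpha> k t) * cnj (z $ k)) * w $ k
        + of_real (lam / 2) * (u $ k + \<i> * of_real (\<alpha> k t) * z $ k) * cnj (w $ k)
        + \<i> * of_real (lam / 2 * \<alpha> k t) * of_real ((cmod (w $ k))\<^sup>2))"
    by (rule shift[OF expand])
  finally show ?thesis
    by (simp only: distrib_right sum_distrib_right mult.assoc)
qed

lemma weyl_symbol_drep:
  fixes \<alpha> :: "'n::finite \<Rightarrow> real ^ 'm::finite \<Rightarrow> real" and z :: "complex ^ 'n"
  assumes lin: "\<And>k. linear (\<alpha> k)" and lam: "lam > 0"
    and ch: "unitary_character ch" and d: "(ch has_derivative dch) (at 0)"
  shows "integrable (mu lam) (weyl_integrand lam (drep \<alpha> lam ch X) z)"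
    and "weyl_symbol lam (drep \<alpha> lam ch X) z = \<i> * complex_of_real (dual_elem
       (\<lambda>t. Re (- \<i> * dch t) + 1 / 2 * (\<Sum>k\<in>UNIV. (1 - lam * (cmod (z $ k))\<^sup>2) * \<alpha> k t))
       (- (lam *\<^sub>R z)) lam X)"
proof -
  obtain t u c where X: "X = (t, u, c)" by (cases X)
  let ?E = "\<lambda>w::complex ^ 'n. exp (- (lam * (norm w)\<^sup>2) :: complex)"
  define K where "K = dch t + \<i> * of_real (lam * c)
      + (\<Sum>k\<in>UNIV. of_real (lam / 2) * (cnj (u $ k) * z $ k - cnj (z $ k) * u $ k)
          - \<i> * of_real (lam / 2 * \<alpha> k t) * (z $ k * cnj (z $ k)))"
  have g0: "has_bochner_integral lborel ?E (of_real ((pi / lam) ^ CARD('n)))"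
    using gaussian_vec[OF lam, of "0 :: complex ^ 'n" 0] by (simp add: bil.zero_left)
  have g1: "has_bochner_integral lborel (\<lambda>w. w $ k * ?E w) 0"
    "has_bochner_integral lborel (\<lambda>w. cnj (w $ k) * ?E w) 0" for k
    using gaussian_vec_moment1[OF lam, where p = "0 :: complex ^ 'n" and q = 0 and j = k] by (simp_all add: bil.zero_left)
  have "has_bochner_integral lborel (weyl_integrand lam (drep \<alpha> lam ch X) z)
    (K * of_real ((pi / lam) ^ CARD('n)) + (\<Sum>k\<in>UNIV.
         of_real (lam / 2) * (cnj (u $ k) - \<i> * of_real (\<alpha> k t) * cnj (z $ k)) * 0
        + of_real (lam / 2) * (u $ k + \<i> * of_real (\<alpha> k t) * z $ k) * 0
        + \<i> * of_real (lam / 2 * \<alpha> k t) * (1 / lam * of_real ((pi / lam) ^ CARD('n)))))"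
    unfolding X weyl_integrand_drep[of \<alpha>, OF assms, abs_def] K_def[symmetric]
    using gaussian_vec_moment2[OF lam, where 'n = 'n]
    by (intro has_bochner_integral_add has_bochner_integral_sum has_bochner_integral_mult_right g0 g1) simp_all
  also have "K * of_real ((pi / lam) ^ CARD('n)) + (\<Sum>k\<in>UNIV.
         of_real (lam / 2) * (cnj (u $ k) - \<i> * of_real (\<alpha> k t) * cnj (z $ k)) * 0
        + of_real (lam / 2) * (u $ k + \<i> * of_real (\<alpha> k t) * z $ k) * 0
        + \<i> * of_real (lam / 2 * \<alpha> k t) * (1 / lam * of_real ((pi / lam) ^ CARD('n)))) =
     (pi / lam) ^ CARD('n) *\<^sub>R (K + (\<Sum>k\<in>UNIV. \<i> * of_real (\<alpha> k t / 2)))"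
    using lam by (simp add: scaleR_conv_of_real sum_distrib_left field_simps)
  finally have int: "has_bochner_integral (mu lam) (weyl_integrand lam (drep \<alpha> lam ch X) z)
     ((lam / (2 * pi)) ^ CARD('n) *\<^sub>R (pi / lam) ^ CARD('n) *\<^sub>R (K + (\<Sum>k\<in>UNIV. \<i> * of_real (\<alpha> k t / 2))))"
    by (rule has_bochner_integral_mu) (rule lam)
  then show "integrable (mu lam) (weyl_integrand lam (drep \<alpha> lam ch X) z)"
    by (simp add: has_bochner_integral_iff)
  have one: "2 ^ CARD('n) * ((lam / (2 * pi)) ^ CARD('n) * (pi / lam) ^ CARD('n)) = 1"
    using lam unfolding power_mult_distrib[symmetric] by simp
  have "weyl_symbol lam (drep \<alpha> lam ch X) z =
     complex_of_real (2 ^ CARD('n) * ((lam / (2 * pi)) ^ CARD('n) * (pi / lam) ^ CARD('n))) * (K + (\<Sum>k\<in>UNIV. \<i> * of_real (\<alpha> k t / 2)))"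
    using int by (simp add: weyl_symbol_def has_bochner_integral_iff scaleR_conv_of_real mult.assoc)
  also have "\<dots> = K + (\<Sum>k\<in>UNIV. \<i> * of_real (\<alpha> k t / 2))"
    unfolding one by simp
  \<comment> \<open>A difference of conjugate numbers is imaginary, which exhibits \<open>K\<close>
    as i times a real number and its first sum as the pairing of -lam z with \<open>u\<close> under
    \<open>symp\<close>.\<close>
  also have "K = \<i> * of_real (Re (- \<i> * dch t)) + \<i> * of_real (lam * c)
      + (\<Sum>k\<in>UNIV. \<i> * of_real (Im (cnj (- (lam *\<^sub>R z) $ k) * u $ k) - lam / 2 * \<alpha> k t * (cmod (z $ k))\<^sup>2))"
  proof -
    have "of_real (lam / 2) * (cnj (u $ k) * z $ k - cnj (z $ k) * u $ k)
          - \<i> * of_real (lam / 2 * \<alpha> k t) * (z $ k * cnj (z $ k)) =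
       \<i> * of_real (Im (cnj (- (lam *\<^sub>R z) $ k) * u $ k) - lam / 2 * \<alpha> k t * (cmod (z $ k))\<^sup>2)" for k
      unfolding complex_norm_square[symmetric] by (simp add: complex_eq_iff field_simps)
    then show ?thesis
      unfolding K_def unitary_character_derivative_imaginary[OF ch d, of t, symmetric] by simp
  qed
  also have "\<i> * of_real (Re (- \<i> * dch t)) + \<i> * of_real (lam * c)
      + (\<Sum>k\<in>UNIV. \<i> * of_real (Im (cnj (- (lam *\<^sub>R z) $ k) * u $ k) - lam / 2 * \<alpha> k t * (cmod (z $ k))\<^sup>2))
      + (\<Sum>k\<in>UNIV. \<i> * of_real (\<alpha> k t / 2)) =
    \<i> * of_real (Re (- \<i> * dch t) + lam * c
      + (\<Sum>k\<in>UNIV. Im (cnj (- (lam *\<^sub>R z) $ k) * u $ k) - lam / 2 * \<alpha> k t * (cmod (z $ k))\<^sup>2)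
      + (\<Sum>k\<in>UNIV. \<alpha> k t / 2))"
    by (simp only: of_real_add of_real_sum sum_distrib_left distrib_left)
  also have "Re (- \<i> * dch t) + lam * c
      + (\<Sum>k\<in>UNIV. Im (cnj (- (lam *\<^sub>R z) $ k) * u $ k) - lam / 2 * \<alpha> k t * (cmod (z $ k))\<^sup>2)
      + (\<Sum>k\<in>UNIV. \<alpha> k t / 2) =
    dual_elem (\<lambda>t. Re (- \<i> * dch t) + 1 / 2 * (\<Sum>k\<in>UNIV. (1 - lam * (cmod (z $ k))\<^sup>2) * \<alpha> k t)) (- (lam *\<^sub>R z)) lam X"
    unfolding X dual_elem_def prod.case symp_eq
    by (simp add: sum.distrib sum_subtractf sum_distrib_left left_diff_distrib sum_divide_distrib algebra_simps)
  finally show "weyl_symbol lam (drep \<alpha> lam ch X) z = \<i> * complex_of_real (dual_elem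
       (\<lambda>t. Re (- \<i> * dch t) + 1 / 2 * (\<Sum>k\<in>UNIV. (1 - lam * (cmod (z $ k))\<^sup>2) * \<alpha> k t))
       (- (lam *\<^sub>R z)) lam X)" .
qed

lemma linear_dual_elem:
  assumes "linear s"
  shows "linear (dual_elem s v d)"
  unfolding dual_elem_def
  using linear_add[OF assms] linear_scale[OF assms]
  by (intro linearI) (auto simp: symp.add_right symp.scaleR_right algebra_simps)

lemma inj_dual_elem:
  fixes s :: "complex ^ 'n::finite \<Rightarrow> real ^ 'm::finite \<Rightarrow> real"
  assumes "lam \<noteq> 0" and zero: "\<And>z. s z 0 = 0"
  shows "inj (\<lambda>z. dual_elem (s z) (- (lam *\<^sub>R z)) lam)"
proof (rule injI)
  fix z z' :: "complex ^ 'n"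
  assume eq: "dual_elem (s z) (- (lam *\<^sub>R z)) lam = dual_elem (s z') (- (lam *\<^sub>R z')) lam"
  \<comment> \<open>Torus coordinate 0 removes the functional \<open>s z\<close>, which itself
    varies with \<open>z\<close>. Multiplication by i turns \<open>symp\<close> into the squared
    norm, so this direction detects any difference.\<close>
  let ?u = "\<chi> k. \<i> * (z - z') $ k"
  have "symp (- (lam *\<^sub>R z)) ?u = symp (- (lam *\<^sub>R z')) ?u"
    using fun_cong[OF eq, of "(0, ?u, 0)"] by (simp add: dual_elem_def zero)
  then have "symp (z - z') ?u = 0"
    using assms(1) by (simp add: symp.minus_left symp.scaleR_left symp.diff_left)
  moreover have "symp (z - z') ?u = (norm (z - z'))\<^sup>2"
    unfolding symp_eq norm_vec_power2 cmod_power2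
    by (intro sum.cong) (auto simp: power2_eq_square algebra_simps)
  ultimately show "z = z'" by simp
qed

theorem proposition7p1:
  fixes \<alpha> :: "'n::finite \<Rightarrow> real ^ 'm::finite \<Rightarrow> real"
    and lam :: real
    and ch :: "real ^ 'm \<Rightarrow> complex"
    and dch :: "real ^ 'm \<Rightarrow> complex"
  assumes "\<And>k. linear (\<alpha> k)"
    and "lam > 0"
    and "unitary_character ch"
    and "(ch has_derivative dch) (at 0)"
  shows "\<exists>\<psi> :: complex ^ 'n \<Rightarrow> ('m, 'n) diamond \<Rightarrow> real.
    (\<forall>z. linear (\<psi> z)) \<and>
    (\<forall>X z. integrable (mu lam) (weyl_integrand lam (drep \<alpha> lam ch X) z) \<and>
           weyl_symbol lam (drep \<alpha> lam ch X) z = \<i> * complex_of_real (\<psi> z X)) \<and>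
    (\<forall>g\<in>carrier (diamond_group \<alpha>). \<forall>z. \<psi> (diamond_act \<alpha> g z) = Ad_star \<alpha> g (\<psi> z)) \<and>
    (\<forall>z. \<psi> z = dual_elem
       (\<lambda>t. Re (- \<i> * dch t) + 1 / 2 * (\<Sum>k\<in>UNIV. (1 - lam * (cmod (z $ k))\<^sup>2) * \<alpha> k t))
       (- (lam *\<^sub>R z)) lam) \<and>
    bij_betw \<psi> UNIV
      (orbit (diamond_group \<alpha>) (Ad_star \<alpha>)
        (dual_elem (\<lambda>t. Re (- \<i> * dch t) + 1 / 2 * (\<Sum>k\<in>UNIV. \<alpha> k t)) 0 lam))"
proof -
  interpret dch: bounded_linear dch by (rule has_derivative_bounded_linear[OF assms(4)])
  \<comment> \<open>The map is defined by its closed form, so part (2) holds by definition and the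
    other claims become properties of this formula.\<close>
  define \<psi> :: "complex ^ 'n \<Rightarrow> ('m, 'n) diamond \<Rightarrow> real" where "\<psi> z = dual_elem
       (\<lambda>t. Re (- \<i> * dch t) + 1 / 2 * (\<Sum>k\<in>UNIV. (1 - lam * (cmod (z $ k))\<^sup>2) * \<alpha> k t))
       (- (lam *\<^sub>R z)) lam" for z
  have lin: "linear (\<psi> z)" for z
  proof -
    have "linear (\<lambda>t. Re (- \<i> * dch t))"
      by (intro linearI) (auto simp: dch.add dch.scaleR)
    moreover have "linear (\<lambda>t. 1 / 2 * (\<Sum>k\<in>UNIV. (1 - lam * (cmod (z $ k))\<^sup>2) * \<alpha> k t))"
      by (intro linearI)
        (simp_all only: linear_add[OF assms(1)] linear_scale[OF assms(1)] distrib_left sum.distrib real_scaleR_def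
           sum_distrib_left mult.left_commute)
    ultimately show ?thesis
      unfolding \<psi>_def by (intro linear_dual_elem linear_compose_add)
  qed
  have equi: "\<psi> (diamond_act \<alpha> g z) = Ad_star \<alpha> g (\<psi> z)" for g z
    unfolding \<psi>_def by (rule Ad_star_dual_elem[of \<alpha>, OF assms(1), symmetric])
  have "inj \<psi>"
    unfolding \<psi>_def[abs_def]
    using assms(2) linear_0[OF assms(1)] by (intro inj_dual_elem) (auto simp: dch.zero)
  moreover have "range \<psi> = orbit (diamond_group \<alpha>) (Ad_star \<alpha>) (\<psi> 0)"
  proof -
    have "torus_act \<alpha> t 0 = 0" for t by (simp add: vec_eq_iff torus_act_nth)
    then have "\<psi> z = Ad_star \<alpha> (0, z, 0) (\<psi> 0)" for z
      using equi[of "(0, z, 0)" 0] by simp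
    then show ?thesis
      \<comment> \<open>The translations just used place the range inside the orbit; conversely,
        equivariance at the base point 0 makes every orbit element a value of \<psi>.\<close>
      unfolding orbit_def using equi[of _ 0, symmetric] by (auto simp: diamond_group_def)
  qed
  moreover have "\<psi> 0 = dual_elem (\<lambda>t. Re (- \<i> * dch t) + 1 / 2 * (\<Sum>k\<in>UNIV. \<alpha> k t)) 0 lam"
    by (simp add: \<psi>_def)
  ultimately have "bij_betw \<psi> UNIV (orbit (diamond_group \<alpha>) (Ad_star \<alpha>)
        (dual_elem (\<lambda>t. Re (- \<i> * dch t) + 1 / 2 * (\<Sum>k\<in>UNIV. \<alpha> k t)) 0 lam))"
    by (simp add: bij_betw_def)
  then show ?thesis
    using lin equi weyl_symbol_drep[of \<alpha>, OF assms] by (intro exI[of _ \<psi>]) (auto simp: \<psi>_def)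
qed

end
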